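(* Let $p \geq 2$, let $\xi_p(z) = \|z\|^p$ and consider the $p$-cost $c(x,y) = \xi_p(x-y) = \|x-y\|^p$ on $\mathbb{R}^d\times\mathbb{R}^d$. Let $\Omega = B(0,R) \subset \mathbb{R}^d$ with $R > 0$ and let $\rho, \tilde{\rho} \in \mathcal{P}(\Omega)$. Assume that $\rho$ is absolutely continuous with respect to the Lebesgue measure, with density bounded from above by $M_\rho \in (0, +\infty)$. Let $\varphi \in \mathcal{C}(\Omega)$ satisfy $\varphi = (\varphi^c)^{\bar{c}}$. Let $\tilde{\gamma} \in \mathcal{P}(\Omega \times \Omega)$ be such that $(p_1)_\# \tilde{\gamma} = \tilde{\rho}$ and assume that $\mathrm{spt}(\tilde{\gamma}) \subset \partial^c \varphi$. Introduce the optimal transport map $T_\varphi : \Omega \to \Omega$ which satisfies, for almost every $x \in \Omega$, $$ T_\varphi(x) = x - (\nabla \xi_p)^{-1} (\nabla \varphi(x)). $$ Then, for any $q \in (p-1, \infty)$ and $r \in (1, \infty)$, $$ \mathrm{W}_q\big((T_\varphi)_\# \rho, (p_2)_\# \tilde{\gamma} \big) \leq c_{d, q, p, R, M_\rho}\, \mathrm{W}_r(\rho, \tilde{\rho})^{\frac{r}{q(r+1)}}, $$ where $$c_{d, q, p, R, M_\rho} = 2^{8(d+1)}\, p^3 \left( \frac{q}{q - p + 1}\right)^{1/q} d^2\,(1 + \beta_d)\, (1+M_\rho)\, (1 + R)^{2 + p + d},$$ with $\beta_d$ denoting the volume of the unit ball of $\mathbb{R}^d$. It also holds, with the same constant, that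 $$ \mathrm{W}_q\big((T_\varphi)_\# \rho, (p_2)_\# \tilde{\gamma} \big) \leq c_{d, q, p, R, M_\rho}\, \mathrm{W}_\infty(\rho, \tilde{\rho})^{\frac{1}{q}} .$$
   Context: $\|\cdot\|$ is the Euclidean norm and $B(0,R)$ is the open Euclidean ball of $\mathbb{R}^d$ centered at $0$ with radius $R$. $\mathcal{P}(X)$ is the set of Borel probability measures on $X$; $\mathrm{spt}$ denotes the support of a measure; $f_\#\nu$ is the image (pushforward) of the measure $\nu$ under $f$; $p_1(x,y) = x$ and $p_2(x,y)=y$ are the coordinate projections. For $s \in [1,\infty)$, $\mathrm{W}_s$ is the $s$-Wasserstein distance, $\mathrm{W}_s(\mu,\nu)^s = \inf_{\gamma} \int \|x-y\|^s \, d\gamma(x,y)$, the infimum being over couplings of $\mu$ and $\nu$; $\mathrm{W}_\infty(\mu,\nu)$ is the infimum over couplings $\gamma$ of the $\gamma$-essential supremum of $\|x-y\|$. For $\varphi : \Omega \to \mathbb{R}$, the $c$-transform is $\varphi^c(y) = \inf_{x \in \Omega} c(x,y) - \varphi(x)$; for a function $\psi$, the $\bar{c}$-transform is $\psi^{\bar{c}}(x) = \inf_{y \in \mathbb{R}^d} c(x,y) - \psi(y)$. The $c$-superdifferential of $\varphi$ is $\partial^c\varphi = \{(x,y) \in \Omega\times\Omega \mid \varphi(x) + \varphi^c(y) = c(x,y)\}$. The map $\nabla \xi_p : \mathbb{R}^d \to \mathbb{R}^d$, $z \mapsto p\|z\|^{p-2} z$, is a bijection, and $(\nabla\xi_p)^{-1}$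 is its inverse. The map $T_\varphi$ is defined almost everywhere, at points of differentiability of $\varphi$, and takes values in $\Omega$. *)

theory Defs
  imports "HOL-Probability.Probability"
begin

definition borel_probs :: "'a::topological_space set \<Rightarrow> 'a measure set" where
  "borel_probs X = {\<mu>. prob_space \<mu> \<and> sets \<mu> = sets (restrict_space borel X)}"

text \<open>For a measure on \<open>X\<close> (that is, with \<open>space \<mu> = X\<close>), the support is taken relative to
  \<open>X\<close>: it is the smallest relatively closed subset of \<open>X\<close> of full measure.\<close>

definition spt :: "'a::topological_space measure \<Rightarrow> 'a set" where
  "spt \<mu> = {x \<in> space \<mu>. \<forall>U. open U \<longrightarrow> x \<in> U \<longrightarrow> emeasure \<mu> (U \<inter> space \<mu>) > 0}"

definition couplings :: "'a measure \<Rightarrow> 'b measure \<Rightarrow> ('a \<times> 'b) measure set" where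
  "couplings \<mu> \<nu> = {\<gamma>. sets \<gamma> = sets (\<mu> \<Otimes>\<^sub>M \<nu>) \<and> distr \<gamma> \<mu> fst = \<mu> \<and> distr \<gamma> \<nu> snd = \<nu>}"

text \<open>Real powers on \<open>[0, \<infinity>]\<close>; only meant for exponents \<open>a > 0\<close>.\<close>

definition ennpowr :: "ennreal \<Rightarrow> real \<Rightarrow> ennreal" where
  "ennpowr x a = (if x = \<infinity> then \<infinity> else ennreal (enn2real x powr a))"

definition wasserstein ::
  "real \<Rightarrow> 'a::euclidean_space measure \<Rightarrow> 'a measure \<Rightarrow> ennreal" where
  "wasserstein s \<mu> \<nu> =
     ennpowr (INF \<gamma>\<in>couplings \<mu> \<nu>. \<integral>\<^sup>+ (x, y). ennreal (norm (x - y) powr s) \<partial>\<gamma>) (1 / s)"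

definition wasserstein_inf ::
  "'a::euclidean_space measure \<Rightarrow> 'a measure \<Rightarrow> ennreal" where
  "wasserstein_inf \<mu> \<nu> =
     (INF \<gamma>\<in>couplings \<mu> \<nu>. esssup \<gamma> (\<lambda>(x, y). ennreal (norm (x - y))))"

text \<open>The transforms are extended-real valued, since the infima may be \<open>-\<infinity>\<close>. In the
  \<open>cbar\<close>-transform no indeterminate difference occurs, the cost being finite.\<close>

definition c_transform ::
  "'a set \<Rightarrow> ('a \<Rightarrow> 'a \<Rightarrow> real) \<Rightarrow> ('a \<Rightarrow> real) \<Rightarrow> 'a \<Rightarrow> ereal" where
  "c_transform \<Omega> c \<phi> y = (INF x\<in>\<Omega>. ereal (c x y - \<phi> x))"

definition cbar_transform ::
  "('a \<Rightarrow> 'a \<Rightarrow> real) \<Rightarrow> ('a \<Rightarrow> ereal) \<Rightarrow> 'a \<Rightarrow> ereal" where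
  "cbar_transform c \<psi> x = (INF y. ereal (c x y) - \<psi> y)"

definition c_superdifferential ::
  "'a set \<Rightarrow> ('a \<Rightarrow> 'a \<Rightarrow> real) \<Rightarrow> ('a \<Rightarrow> real) \<Rightarrow> ('a \<times> 'a) set" where
  "c_superdifferential \<Omega> c \<phi> =
     {(x, y) \<in> \<Omega> \<times> \<Omega>. ereal (\<phi> x) + c_transform \<Omega> c \<phi> y = ereal (c x y)}"

definition xi :: "real \<Rightarrow> 'a::euclidean_space \<Rightarrow> real" where
  "xi p z = norm z powr p"

definition p_cost :: "real \<Rightarrow> 'a::euclidean_space \<Rightarrow> 'a \<Rightarrow> real" where
  "p_cost p x y = xi p (x - y)"

text \<open>The gradient of \<^term>\<open>xi p\<close> for \<open>p \<ge> 2\<close>; a bijection of the whole space, so that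
  \<^term>\<open>inv (grad_xi p)\<close> is its inverse.\<close>

definition grad_xi :: "real \<Rightarrow> 'a::euclidean_space \<Rightarrow> 'a" where
  "grad_xi p z = (p * norm z powr (p - 2)) *\<^sub>R z"

text \<open>Since a Borel map is determined by its formula only almost everywhere, this is a predicate:
  \<open>T\<close> is a Borel map from \<open>\<Omega>\<close> to \<open>\<Omega>\<close> given by the formula at almost every point of \<open>\<Omega>\<close> at
  which \<open>\<phi>\<close> is differentiable. Differentiability almost everywhere is not part of the
  predicate; for a \<open>c\<close>-concave \<open>\<phi>\<close> it holds automatically.\<close>

definition is_ot_map ::
  "real \<Rightarrow> 'a::euclidean_space set \<Rightarrow> ('a \<Rightarrow> real) \<Rightarrow> ('a \<Rightarrow> 'a) \<Rightarrow> bool" where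
  "is_ot_map p \<Omega> \<phi> T \<longleftrightarrow>
     T \<in> restrict_space borel \<Omega> \<rightarrow>\<^sub>M restrict_space borel \<Omega> \<and>
     (AE x in lborel. x \<in> \<Omega> \<longrightarrow> (\<forall>g. GDERIV \<phi> x :> g \<longrightarrow> T x = x - inv (grad_xi p) g))"

definition stability_const :: "nat \<Rightarrow> real \<Rightarrow> real \<Rightarrow> real \<Rightarrow> real \<Rightarrow> real" where
  "stability_const d q p R M =
     2 ^ (8 * (d + 1)) * p ^ 3 * (q / (q - p + 1)) powr (1 / q) * (real d)\<^sup>2
       * (1 + unit_ball_vol (real d)) * (1 + M) * (1 + R) powr (2 + p + real d)"

end

theory Submission
  imports Defs
begin

text \<open>
  Write \<open>c\<close> for the cost. A pair \<open>(x, y)\<close> in the \<open>c\<close>-superdifferential of \<open>\<phi>\<close> touches \<open>\<phi>\<close> from above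
  at \<open>x\<close> by the function \<open>z \<mapsto> \<phi> x + c z y - c x y\<close>. For \<open>p \<ge> 2\<close> the cost has a Lipschitz
  gradient on bounded sets, so these functions are, up to a quadratic term, affine with slope
  \<open>\<nabla>\<xi> (x - y)\<close>: the potential is semiconcave and the vectors \<open>\<nabla>\<xi> (x - y)\<close> are its supergradients.
  The gradient \<open>\<nabla>\<xi>\<close> is moreover strongly monotone, so a bound on the difference of two supergradients
  at nearby points is a bound on the difference of the corresponding \<open>y\<close>.

  The whole argument rests on one quantity, the sum \<open>S\<close> of the second differences of the potential
  with step \<open>s\<close> in the coordinate directions (\<open>second_diff\<close>).
  Pointwise, \<open>S x\<close> controls how far the potential can lie below its tangent near \<open>x\<close>, because a small
  ball around \<open>x\<close> lies in the convex hull of the points \<open>x \<plusminus> s e\<close> (\<open>supergradient_lower_bound\<close>);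
  therefore all supergradients at points within distance \<open>\<eta>\<close> of \<open>x\<close>, with \<open>s\<close> comparable to \<open>\<eta>\<close>, differ
  by at most a constant times \<open>S x / \<eta> + \<eta>\<close> (\<open>supergradients_close\<close>).
  On average, \<open>S\<close> is small: a second difference is the difference between a first difference and its
  translate, so its integral over a ball reduces to an integral over a thin annulus and is \<open>O(s\<^sup>2)\<close>
  (\<open>nn_integral_second_diff_le\<close>). Both facts together give almost everywhere differentiability (let
  \<open>s\<close> tend to \<open>0\<close>) and, with \<open>s\<close> comparable to \<open>\<eta>\<close>, a function \<open>G\<close> with integral \<open>O(\<eta>)\<close> such that
  \<open>norm (y - y') powr (p - 1) \<le> G x\<close> for all pairs \<open>(x, y)\<close>, \<open>(x', y')\<close> of the superdifferential
  with \<open>x'\<close> within \<open>\<eta>\<close> of \<open>x\<close> (\<open>displacement_bound_near_most_points\<close>).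

  It remains to transport this to measures. Given a coupling of \<open>\<rho>\<close> and \<open>\<rho>'\<close> and the plan \<open>\<gamma>'\<close>, a
  coupling of \<open>\<rho>\<close>-mass at \<open>x\<close> with \<open>\<gamma>'\<close>-mass at \<open>(x', y)\<close> is needed in which \<open>x'\<close> is close to the partner
  of \<open>x\<close>. Instead of disintegrating, one cuts the space into cells of diameter at most \<open>h\<close> and matches
  mass cell by cell (\<open>coupling_matching_observable\<close>); equality of the midpoints is lost, but only up to
  \<open>h\<close>, which the estimate tolerates. This bounds the cost between \<open>T x\<close> and \<open>y\<close> by a constant times
  \<open>h\<close> plus the probability that the two points of the given coupling are more than \<open>h\<close> apart. Markov's
  inequality and the optimal choice of \<open>h\<close> conclude; for the distance of order \<open>\<infinity>\<close> the probability
  vanishes as soon as \<open>h\<close> exceeds it.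
\<close>

section \<open>The cost and its gradient\<close>

lemma norm_grad_xi:
  fixes z :: "'a::euclidean_space"
  assumes "p \<ge> 2" shows "norm (grad_xi p z) = p * norm z powr (p - 1)"
proof (cases "z = 0")
  case False
  have "norm z powr (p - 1) = norm z powr (p - 2) * norm z powr 1"
    by (subst powr_add [symmetric]) simp
  with False assms show ?thesis by (simp add: grad_xi_def)
qed (use assms in \<open>simp add: grad_xi_def\<close>)

text \<open>This is Young's inequality for the exponents \<open>p\<close> and \<open>p / (p - 1)\<close>. Read in both directions it
  sandwiches the increments of the cost between two values of the gradient, which replaces every
  differentiation of the cost.\<close>

lemma xi_above_tangent:
  fixes a b :: "'a::euclidean_space"
  assumes p: "p \<ge> 2"
  shows "xi p a + grad_xi p a \<bullet> (b - a) \<le> xi p b"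
proof (cases "a = 0")
  case True
  then show ?thesis using p by (simp add: grad_xi_def xi_def)
next
  case False
  define n where "n = norm a"
  have n: "n > 0" using False by (simp add: n_def)
  have aa: "a \<bullet> a = n * n" by (simp add: n_def dot_square_norm power2_eq_square)
  have np: "n powr p = n powr (p - 2) * (n * n)" "n powr (p - 1) = n powr (p - 2) * n"
    using n by (simp_all flip: powr_add powr_mult add: powr_diff powr_numeral power2_eq_square)
  have q: "1 / p + 1 / (p / (p - 1)) = 1" "p / (p - 1) > 1" using p by (auto simp: field_simps)
  have "norm b * n powr (p - 1) \<le> norm b powr p / p + (n powr (p - 1)) powr (p / (p - 1)) / (p / (p - 1))"
    by (rule Youngs_inequality) (use p q in auto)
  also have "(n powr (p - 1)) powr (p / (p - 1)) = n powr p"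
    using p by (simp add: powr_powr)
  finally have "p * (norm b * n powr (p - 1)) \<le> norm b powr p + (p - 1) * n powr p"
    using p by (simp add: field_simps)
  moreover have "a \<bullet> b \<le> n * norm b" unfolding n_def by (rule norm_cauchy_schwarz)
  then have "p * n powr (p - 2) * (a \<bullet> b) \<le> p * n powr (p - 2) * (n * norm b)"
    using p by (intro mult_left_mono) auto
  ultimately have "p * n powr (p - 2) * (a \<bullet> b) \<le> norm b powr p + (p - 1) * n powr p"
    by (simp add: np mult_ac)
  then show ?thesis
    by (simp add: xi_def grad_xi_def inner_diff_right aa flip: n_def) (simp add: np algebra_simps)
qed

text \<open>Split the difference into a change of direction and a change of length. For the latter the mean
  value theorem for \<open>t \<mapsto> t powr (p - 2)\<close> loses nothing even when \<open>p < 3\<close> and the derivative is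
  singular at the origin, because the difference is multiplied by the smaller of the two lengths.\<close>

lemma grad_xi_lipschitz:
  fixes a b :: "'a::euclidean_space"
  assumes p: "p \<ge> 2" and "norm a \<le> K" "norm b \<le> K"
  shows "norm (grad_xi p a - grad_xi p b) \<le> p * (p - 1) * K powr (p - 2) * norm (a - b)"
proof -
  have *: "norm (grad_xi p a - grad_xi p b) \<le> p * (p - 1) * K powr (p - 2) * norm (a - b)"
    if ab: "norm b \<le> norm a" "norm a \<le> K" for a b :: 'a
  proof (cases "b = 0")
    case True
    have "norm a powr (p - 1) \<le> (p - 1) * K powr (p - 2) * norm a"
    proof (cases "a = 0")
      case False
      then have "norm a powr (p - 1) = norm a powr (p - 2) * norm a"
        using powr_add [of "norm a" "p - 2" 1] by simp
      also have "\<dots> \<le> K powr (p - 2) * norm a"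
        using p ab by (intro mult_right_mono powr_mono2) auto
      also have "\<dots> \<le> (p - 1) * (K powr (p - 2) * norm a)"
        using p mult_right_mono [of 1 "p - 1" "K powr (p - 2) * norm a"] by simp
      finally show ?thesis by (simp add: mult_ac)
    qed simp
    then have "p * norm a powr (p - 1) \<le> p * ((p - 1) * K powr (p - 2) * norm a)"
      using p by (intro mult_left_mono) auto
    then show ?thesis
      using True p by (simp add: norm_grad_xi [symmetric] mult_ac) (simp add: grad_xi_def)
  next
    case False
    define m where "m = p - 2"
    define \<alpha> \<beta> where "\<alpha> = norm a" and "\<beta> = norm b"
    have m: "m \<ge> 0" and \<beta>: "0 < \<beta>" "\<beta> \<le> \<alpha>" "\<alpha> \<le> K" and d: "\<alpha> - \<beta> \<le> norm (a - b)"
      using p False ab norm_triangle_ineq2 [of a b] by (auto simp: m_def \<alpha>_def \<beta>_def)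
    have mono: "\<beta> powr m \<le> \<alpha> powr m" using \<beta> m by (intro powr_mono2) auto
    \<comment> \<open>The mean value point lies above \<open>\<beta>\<close>, which absorbs the possibly singular power \<open>m - 1\<close>.\<close>
    have diff: "(\<alpha> powr m - \<beta> powr m) * \<beta> \<le> m * \<alpha> powr m * (\<alpha> - \<beta>)"
    proof (cases "\<alpha> = \<beta>")
      case False
      then have "\<beta> < \<alpha>" using \<beta> by simp
      moreover have "((\<lambda>t. t powr m) has_real_derivative (m * t powr (m - 1))) (at t)"
        if "\<beta> \<le> t" "t \<le> \<alpha>" for t
        using that \<beta> by (intro has_real_derivative_powr) auto
      ultimately obtain t where t: "\<beta> < t" "t < \<alpha>"
          "\<alpha> powr m - \<beta> powr m = (\<alpha> - \<beta>) * (m * t powr (m - 1))"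
        using MVT2 [of \<beta> \<alpha> "\<lambda>t. t powr m" "\<lambda>t. m * t powr (m - 1)"] by blast
      have "t powr (m - 1) * \<beta> \<le> t powr (m - 1) * t"
        using t by (intro mult_left_mono) auto
      also have "\<dots> = t powr m" using t \<beta> by (simp add: powr_diff)
      also have "\<dots> \<le> \<alpha> powr m" using t \<beta> m by (intro powr_mono2) auto
      finally have "(\<alpha> - \<beta>) * m * (t powr (m - 1) * \<beta>) \<le> (\<alpha> - \<beta>) * m * \<alpha> powr m"
        using \<beta> m by (intro mult_left_mono) auto
      then show ?thesis by (simp add: t(3) mult_ac)
    qed simp
    have "\<alpha> powr m *\<^sub>R a - \<beta> powr m *\<^sub>R b = \<alpha> powr m *\<^sub>R (a - b) + (\<alpha> powr m - \<beta> powr m) *\<^sub>R b"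
      by (simp add: algebra_simps)
    then have "norm (\<alpha> powr m *\<^sub>R a - \<beta> powr m *\<^sub>R b)
        \<le> norm (\<alpha> powr m *\<^sub>R (a - b)) + norm ((\<alpha> powr m - \<beta> powr m) *\<^sub>R b)"
      by (metis norm_triangle_ineq)
    also have "\<dots> = \<alpha> powr m * norm (a - b) + (\<alpha> powr m - \<beta> powr m) * \<beta>"
      using mono by (simp add: \<beta>_def)
    also have "\<dots> \<le> \<alpha> powr m * norm (a - b) + m * \<alpha> powr m * norm (a - b)"
      using diff mult_left_mono [OF d, of "m * \<alpha> powr m"] m by simp
    also have "\<dots> = \<alpha> powr m * ((1 + m) * norm (a - b))" by (simp add: algebra_simps)
    also have "\<dots> \<le> K powr m * ((1 + m) * norm (a - b))"
      using \<beta> m by (intro mult_right_mono powr_mono2) auto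
    finally have "p * norm (\<alpha> powr m *\<^sub>R a - \<beta> powr m *\<^sub>R b) \<le> p * (K powr m * ((1 + m) * norm (a - b)))"
      using p by (intro mult_left_mono) auto
    moreover have "grad_xi p a - grad_xi p b = p *\<^sub>R (\<alpha> powr m *\<^sub>R a - \<beta> powr m *\<^sub>R b)"
      by (simp add: grad_xi_def m_def \<alpha>_def \<beta>_def algebra_simps)
    ultimately show ?thesis using p by (simp add: m_def mult_ac)
  qed
  show ?thesis
    using *[of b a] *[of a b] assms by (cases "norm b \<le> norm a") (auto simp: norm_minus_commute)
qed

text \<open>The inner product of the difference of the gradients with \<open>a - b\<close> is, up to the factor \<open>p\<close>, the
  average of the two weights times \<open>(norm (a - b))\<^sup>2\<close> plus a nonnegative term, and one of \<open>a\<close>, \<open>b\<close>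
  has at least half the norm of \<open>a - b\<close>.\<close>

lemma grad_xi_strongly_monotone:
  fixes a b :: "'a::euclidean_space"
  assumes p: "p \<ge> 2"
  shows "p / 2 powr (p - 1) * norm (a - b) powr (p - 1) \<le> norm (grad_xi p a - grad_xi p b)"
proof (cases "a = b")
  case False
  define m where "m = p - 2"
  define \<alpha> \<beta> where "\<alpha> = norm a" and "\<beta> = norm b"
  define \<delta> where "\<delta> = norm (a - b)"
  have m: "m \<ge> 0" and \<alpha>: "\<alpha> \<ge> 0" "\<beta> \<ge> 0" and \<delta>: "\<delta> > 0" using p False by (auto simp: m_def \<alpha>_def \<beta>_def \<delta>_def)
  have tri: "\<delta> \<le> \<alpha> + \<beta>" unfolding \<alpha>_def \<beta>_def \<delta>_def by (rule norm_triangle_ineq4)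
  have sq: "a \<bullet> a = \<alpha>\<^sup>2" "b \<bullet> b = \<beta>\<^sup>2" "(a - b) \<bullet> (a - b) = \<delta>\<^sup>2"
    by (simp_all add: \<alpha>_def \<beta>_def \<delta>_def dot_square_norm)
  have "(\<delta> / 2) powr m \<le> \<alpha> powr m + \<beta> powr m"
  proof (cases "\<delta> / 2 \<le> \<alpha>")
    case True
    then have "(\<delta> / 2) powr m \<le> \<alpha> powr m" using m \<delta> by (intro powr_mono2) auto
    then show ?thesis using powr_ge_zero [of \<beta> m] by linarith
  next
    case False
    then have "(\<delta> / 2) powr m \<le> \<beta> powr m" using m \<delta> tri by (intro powr_mono2) auto
    then show ?thesis using powr_ge_zero [of \<alpha> m] by linarith
  qed
  then have "(\<delta> / 2) powr m * (\<delta> * \<delta>) / 2 \<le> (\<alpha> powr m + \<beta> powr m) / 2 * \<delta>\<^sup>2"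
    using mult_right_mono [of "(\<delta> / 2) powr m" "\<alpha> powr m + \<beta> powr m" "\<delta> * \<delta> / 2"]
    by (simp add: power2_eq_square)
  also have "\<dots> \<le> (\<alpha> powr m + \<beta> powr m) / 2 * \<delta>\<^sup>2 + (\<alpha> powr m - \<beta> powr m) * (\<alpha>\<^sup>2 - \<beta>\<^sup>2) / 2"
  proof -
    have "0 \<le> (\<alpha> powr m - \<beta> powr m) * (\<alpha>\<^sup>2 - \<beta>\<^sup>2)"
    proof (cases "\<alpha> \<le> \<beta>")
      case True
      then show ?thesis using m \<alpha> by (intro mult_nonpos_nonpos) (auto intro!: powr_mono2 power_mono)
    next
      case False
      then show ?thesis using m \<alpha> by (intro mult_nonneg_nonneg) (auto intro!: powr_mono2 power_mono)
    qed
    then show ?thesis by simp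
  qed
  also have "\<dots> = (\<alpha> powr m *\<^sub>R a - \<beta> powr m *\<^sub>R b) \<bullet> (a - b)"
    unfolding sq [symmetric] by (simp add: algebra_simps inner_commute add_divide_distrib diff_divide_distrib)
  also have "\<dots> \<le> norm (\<alpha> powr m *\<^sub>R a - \<beta> powr m *\<^sub>R b) * \<delta>"
    unfolding \<delta>_def by (rule norm_cauchy_schwarz)
  finally have "(\<delta> / 2) powr m * \<delta> / 2 \<le> norm (\<alpha> powr m *\<^sub>R a - \<beta> powr m *\<^sub>R b)"
    using \<delta> by (simp add: field_simps)
  moreover have "grad_xi p a - grad_xi p b = p *\<^sub>R (\<alpha> powr m *\<^sub>R a - \<beta> powr m *\<^sub>R b)"
    by (simp add: grad_xi_def m_def \<alpha>_def \<beta>_def algebra_simps)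
  moreover have "(\<delta> / 2) powr m * \<delta> / 2 = \<delta> powr (p - 1) / 2 powr (p - 1)"
  proof -
    have "(\<delta> / 2) powr (p - 1) = (\<delta> / 2) powr m * (\<delta> / 2) powr 1"
      unfolding powr_add [symmetric] by (simp add: m_def)
    then show ?thesis using \<delta> by (simp add: powr_divide)
  qed
  ultimately have "p * (\<delta> powr (p - 1) / 2 powr (p - 1)) \<le> norm (grad_xi p a - grad_xi p b)"
    using p mult_left_mono [of "\<delta> powr (p - 1) / 2 powr (p - 1)" _ p] by simp
  then show ?thesis by (simp add: \<delta>_def)
qed (use p in simp)

lemma inj_grad_xi:
  assumes p: "p \<ge> 2" shows "inj (grad_xi p :: 'a::euclidean_space \<Rightarrow> 'a)"
proof (rule injI)
  fix a b :: 'a assume "grad_xi p a = grad_xi p b"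
  with grad_xi_strongly_monotone [OF p, of a b] p
  have "norm (a - b) powr (p - 1) \<le> 0" by (simp add: mult_le_0_iff not_le divide_le_0_iff)
  then show "a = b" by simp
qed

text \<open>Bounding the increment by the gradient at the end point and moving that gradient to \<open>a\<close> costs a
  factor \<open>2\<close> compared with Taylor's formula, but avoids derivatives.\<close>

lemma xi_upper_quadratic:
  fixes a b :: "'a::euclidean_space"
  assumes p: "p \<ge> 2" and K: "norm a \<le> K" "norm b \<le> K"
  shows "xi p b \<le> xi p a + grad_xi p a \<bullet> (b - a) + p * (p - 1) * K powr (p - 2) * (norm (b - a))\<^sup>2"
proof -
  have "xi p b \<le> xi p a + grad_xi p b \<bullet> (b - a)"
    using xi_above_tangent [OF p, of b a] by (simp add: inner_diff_right)
  also have "grad_xi p b \<bullet> (b - a) = grad_xi p a \<bullet> (b - a) + (grad_xi p b - grad_xi p a) \<bullet> (b - a)"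
    by (simp add: inner_diff_left)
  also have "(grad_xi p b - grad_xi p a) \<bullet> (b - a) \<le> norm (grad_xi p b - grad_xi p a) * norm (b - a)"
    by (rule norm_cauchy_schwarz)
  also have "\<dots> \<le> p * (p - 1) * K powr (p - 2) * norm (b - a) * norm (b - a)"
    by (intro mult_right_mono grad_xi_lipschitz assms) auto
  finally show ?thesis by (simp add: power2_eq_square mult_ac)
qed

lemma xi_lipschitz:
  fixes a b :: "'a::euclidean_space"
  assumes p: "p \<ge> 2" and K: "norm b \<le> K"
  shows "xi p b - xi p a \<le> p * K powr (p - 1) * norm (b - a)"
proof -
  have "xi p b - xi p a \<le> grad_xi p b \<bullet> (b - a)"
    using xi_above_tangent [OF p, of b a] by (simp add: inner_diff_right)
  also have "\<dots> \<le> norm (grad_xi p b) * norm (b - a)" by (rule norm_cauchy_schwarz)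
  also have "\<dots> \<le> p * K powr (p - 1) * norm (b - a)"
    unfolding norm_grad_xi [OF p] using p K by (intro mult_right_mono mult_left_mono powr_mono2) auto
  finally show ?thesis .
qed

lemma p_cost_upper_quadratic:
  fixes x y z :: "'a::euclidean_space"
  assumes "p \<ge> 2" "norm (x - y) \<le> K" "norm (z - y) \<le> K"
  shows "p_cost p z y \<le> p_cost p x y + grad_xi p (x - y) \<bullet> (z - x)
      + p * (p - 1) * K powr (p - 2) * (norm (z - x))\<^sup>2"
  using xi_upper_quadratic [OF assms] by (simp add: p_cost_def)

lemma p_cost_lipschitz:
  fixes x y z :: "'a::euclidean_space"
  assumes "p \<ge> 2" "norm (z - y) \<le> K"
  shows "p_cost p z y - p_cost p x y \<le> p * K powr (p - 1) * norm (z - x)"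
  using xi_lipschitz [OF assms, of "x - y"] by (simp add: p_cost_def)

lemma continuous_on_p_cost:
  assumes "p \<ge> 2" shows "continuous_on UNIV (\<lambda>y :: 'a::euclidean_space. p_cost p x y)"
  unfolding p_cost_def xi_def
  by (rule continuous_on_powr') (use assms in \<open>auto intro!: continuous_intros\<close>)

section \<open>Semiconcave functions and second differences\<close>

text \<open>The slack \<open>\<epsilon>\<close> makes the notion stable under infima that are not attained: the potential is
  extended below as an infimum over a set that need not be compact.\<close>

definition semiconcave_on :: "'a::real_inner set \<Rightarrow> real \<Rightarrow> ('a \<Rightarrow> real) \<Rightarrow> bool" where
  "semiconcave_on U \<kappa> f \<longleftrightarrow>
     (\<forall>x\<in>U. \<forall>\<epsilon>>0. \<exists>g. \<forall>z\<in>U. f z \<le> f x + g \<bullet> (z - x) + \<kappa> * (norm (z - x))\<^sup>2 + \<epsilon>)"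

text \<open>The term \<open>2 * \<kappa> * s\<^sup>2\<close> compensates the curvature, so that each summand is nonnegative for a
  semiconcave function with constant \<open>\<kappa>\<close>.\<close>

definition second_diff :: "real \<Rightarrow> real \<Rightarrow> ('a::euclidean_space \<Rightarrow> real) \<Rightarrow> 'a \<Rightarrow> real" where
  "second_diff \<kappa> s f x =
     (\<Sum>e\<in>Basis. 2 * f x - f (x + s *\<^sub>R e) - f (x - s *\<^sub>R e) + 2 * \<kappa> * s\<^sup>2)"

lemma semiconcave_on_jensen:
  fixes f :: "'a::real_inner \<Rightarrow> real"
  assumes sc: "semiconcave_on U \<kappa> f"
    and w: "\<And>j. j \<in> J \<Longrightarrow> w j \<ge> 0" "sum w J = 1"
    and y: "\<And>j. j \<in> J \<Longrightarrow> y j \<in> U"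
    and z: "(\<Sum>j\<in>J. w j *\<^sub>R y j) = z" "z \<in> U"
  shows "(\<Sum>j\<in>J. w j * f (y j)) \<le> f z + \<kappa> * (\<Sum>j\<in>J. w j * (norm (y j - z))\<^sup>2)"
proof (rule field_le_epsilon)
  fix \<epsilon> :: real assume "\<epsilon> > 0"
  with sc z obtain g
    where g: "\<And>x. x \<in> U \<Longrightarrow> f x \<le> f z + g \<bullet> (x - z) + \<kappa> * (norm (x - z))\<^sup>2 + \<epsilon>"
    unfolding semiconcave_on_def by blast
  have "(\<Sum>j\<in>J. w j * f (y j))
      \<le> (\<Sum>j\<in>J. w j * (f z + g \<bullet> (y j - z) + \<kappa> * (norm (y j - z))\<^sup>2 + \<epsilon>))"
    by (intro sum_mono mult_left_mono g y w)
  also have "\<dots> = (\<Sum>j\<in>J. w j) * (f z + \<epsilon>) + (\<Sum>j\<in>J. w j * (g \<bullet> (y j - z)))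
      + \<kappa> * (\<Sum>j\<in>J. w j * (norm (y j - z))\<^sup>2)"
    by (simp add: sum_distrib_left sum_distrib_right algebra_simps sum.distrib sum_subtractf)
  also have "(\<Sum>j\<in>J. w j * (g \<bullet> (y j - z))) = g \<bullet> (\<Sum>j\<in>J. w j *\<^sub>R y j) - sum w J * (g \<bullet> z)"
    by (simp add: inner_sum_right inner_diff_right right_diff_distrib sum_subtractf sum_distrib_right)
  finally show "(\<Sum>j\<in>J. w j * f (y j))
      \<le> f z + \<kappa> * (\<Sum>j\<in>J. w j * (norm (y j - z))\<^sup>2) + \<epsilon>"
    by (simp add: z w)
qed

lemma second_difference_nonneg:
  fixes f :: "'a::real_inner \<Rightarrow> real"
  assumes sc: "semiconcave_on U \<kappa> f" and x: "x \<in> U" "x + v \<in> U" "x - v \<in> U"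
  shows "0 \<le> 2 * f x - f (x + v) - f (x - v) + 2 * \<kappa> * (norm v)\<^sup>2"
proof (rule field_le_epsilon)
  fix \<epsilon> :: real assume "\<epsilon> > 0"
  then have "\<epsilon> / 2 > 0" by simp
  with sc x obtain g
    where g: "\<And>z. z \<in> U \<Longrightarrow> f z \<le> f x + g \<bullet> (z - x) + \<kappa> * (norm (z - x))\<^sup>2 + \<epsilon> / 2"
    unfolding semiconcave_on_def by blast
  show "0 \<le> 2 * f x - f (x + v) - f (x - v) + 2 * \<kappa> * (norm v)\<^sup>2 + \<epsilon>"
    using g [OF x(2)] g [OF x(3)] by simp
qed

lemma second_diff_nonneg:
  assumes "semiconcave_on U \<kappa> f" "x \<in> U"
    and "\<And>e. e \<in> Basis \<Longrightarrow> x + s *\<^sub>R e \<in> U \<and> x - s *\<^sub>R e \<in> U"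
  shows "0 \<le> second_diff \<kappa> s f x"
  unfolding second_diff_def
proof (intro sum_nonneg)
  fix e :: 'a assume e: "e \<in> Basis"
  with assms(3) [OF e] second_difference_nonneg [OF assms(1,2), of "s *\<^sub>R e"]
  show "0 \<le> 2 * f x - f (x + s *\<^sub>R e) - f (x - s *\<^sub>R e) + 2 * \<kappa> * s\<^sup>2" by simp
qed

text \<open>If \<open>norm v\<close> is at most \<open>s\<close> divided by the dimension, \<open>x + v\<close> is the barycentre of \<open>x\<close> and of the
  vertices \<open>x \<plusminus> s e\<close>, where the sign is that of the coordinate of \<open>v\<close> and the weight is the absolute
  value of this coordinate divided by \<open>s\<close>. At each vertex the defect of \<open>f\<close> below its upper tangent
  is at most the corresponding summand of \<open>second_diff\<close>, since the defect at the opposite vertex is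
  nonnegative. Jensen's inequality carries the bound over to \<open>x + v\<close>. The quadratic error terms
  cancel because the variance of the barycentric weights is at most their second moment about \<open>x\<close>.\<close>

lemma supergradient_lower_bound:
  fixes f :: "'a::euclidean_space \<Rightarrow> real"
  assumes sc: "semiconcave_on U \<kappa> f"
    and s: "s > 0" and x: "x \<in> U" "x + v \<in> U"
    and star: "\<And>e. e \<in> Basis \<Longrightarrow> x + s *\<^sub>R e \<in> U \<and> x - s *\<^sub>R e \<in> U"
    and v: "real DIM('a) * norm v \<le> s"
    and \<kappa>: "\<kappa> \<ge> 0"
    and g: "\<And>z. z \<in> U \<Longrightarrow> f z \<le> f x + g \<bullet> (z - x) + \<kappa> * (norm (z - x))\<^sup>2"
  shows "f x + g \<bullet> v - norm v / s * second_diff \<kappa> s f x \<le> f (x + v)"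
proof -
  define D where "D e = 2 * f x - f (x + s *\<^sub>R e) - f (x - s *\<^sub>R e) + 2 * \<kappa> * s\<^sup>2" for e :: 'a
  define \<tau> where "\<tau> = (\<Sum>e\<in>Basis. \<bar>v \<bullet> e\<bar> / s)"
  \<comment> \<open>The index \<open>0\<close>, which is not a basis vector, stands for the centre \<open>x\<close> itself.\<close>
  define w where "w e = (if e = 0 then 1 - \<tau> else \<bar>v \<bullet> e\<bar> / s)" for e :: 'a
  define y where "y e = x + (s * sgn (v \<bullet> e)) *\<^sub>R e" for e :: 'a
  have wB: "w e = \<bar>v \<bullet> e\<bar> / s" if "e \<in> Basis" for e using that by (auto simp: w_def)
  have zB: "(0::'a) \<notin> Basis" by simp
  have "\<tau> \<le> (\<Sum>e\<in>(Basis :: 'a set). norm v / s)"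
    unfolding \<tau>_def using s by (intro sum_mono divide_right_mono Basis_le_norm) auto
  also have "\<dots> \<le> 1" using v s by (simp add: field_simps)
  finally have \<tau>: "\<tau> \<le> 1" .
  have split: "(\<Sum>j\<in>insert 0 Basis. w j * F j) = (1 - \<tau>) * F 0 + (\<Sum>e\<in>Basis. \<bar>v \<bullet> e\<bar> / s * F e)"
    for F :: "'a \<Rightarrow> real"
  proof -
    have "(\<Sum>j\<in>insert 0 Basis. w j * F j) = (1 - \<tau>) * F 0 + (\<Sum>j\<in>Basis. w j * F j)"
      by (simp add: w_def)
    also have "(\<Sum>j\<in>Basis. w j * F j) = (\<Sum>e\<in>Basis. \<bar>v \<bullet> e\<bar> / s * F e)"
      by (intro sum.cong) (auto simp: wB)
    finally show ?thesis .
  qed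
  have sw: "sum w (insert 0 Basis) = 1" using split [of "\<lambda>_. 1"] by (simp add: \<tau>_def)
  have wy: "w e *\<^sub>R y e = w e *\<^sub>R x + (v \<bullet> e) *\<^sub>R e" if "e \<in> insert 0 Basis" for e
    using that s by (auto simp: y_def w_def algebra_simps abs_mult_sgn)
  have bary: "(\<Sum>j\<in>insert 0 Basis. w j *\<^sub>R y j) = x + v"
  proof -
    have "(\<Sum>j\<in>insert 0 Basis. w j *\<^sub>R y j) = (\<Sum>j\<in>insert 0 Basis. w j *\<^sub>R x + (v \<bullet> j) *\<^sub>R j)"
      by (intro sum.cong wy) auto
    also have "\<dots> = sum w (insert 0 Basis) *\<^sub>R x + (\<Sum>j\<in>Basis. (v \<bullet> j) *\<^sub>R j)"
      unfolding sum.distrib scaleR_left.sum [symmetric] by simp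
    finally show ?thesis by (simp add: sw euclidean_representation)
  qed
  have "(\<Sum>j\<in>insert 0 Basis. w j * f (y j))
      \<le> f (x + v) + \<kappa> * (\<Sum>j\<in>insert 0 Basis. w j * (norm (y j - (x + v)))\<^sup>2)"
  proof (rule semiconcave_on_jensen [OF sc _ sw _ bary])
    show "w j \<ge> 0" if "j \<in> insert 0 Basis" for j using \<tau> s by (auto simp: w_def)
    show "y j \<in> U" if "j \<in> insert 0 Basis" for j
      using that x star [of j] by (auto simp: y_def sgn_if)
  qed (use x in auto)
  moreover have "(\<Sum>j\<in>insert 0 Basis. w j * (norm (y j - (x + v)))\<^sup>2) \<le> \<tau> * s\<^sup>2"
  proof -
    have "\<bar>v \<bullet> e\<bar> / s * (norm (y e - (x + v)))\<^sup>2 = \<bar>v \<bullet> e\<bar> / s * (s\<^sup>2 + (norm v)\<^sup>2) - 2 * (v \<bullet> e)\<^sup>2"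
      if "e \<in> Basis" for e
    proof -
      have "(norm (y e - (x + v)))\<^sup>2 = (s * sgn (v \<bullet> e))\<^sup>2 - 2 * (s * sgn (v \<bullet> e)) * (v \<bullet> e) + (norm v)\<^sup>2"
      proof -
        have "(norm (c *\<^sub>R e - v))\<^sup>2 = c\<^sup>2 - 2 * c * (v \<bullet> e) + (norm v)\<^sup>2" for c
          using that unfolding power2_norm_eq_inner
          by (simp add: inner_diff_left inner_diff_right inner_commute power2_eq_square)
        moreover have "y e - (x + v) = (s * sgn (v \<bullet> e)) *\<^sub>R e - v" by (simp add: y_def)
        ultimately show ?thesis by (simp only:)
      qed
      moreover have "\<bar>c\<bar> / s * ((s * sgn c)\<^sup>2 - 2 * (s * sgn c) * c + N) = \<bar>c\<bar> / s * (s\<^sup>2 + N) - 2 * c\<^sup>2" for c N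
        using s by (cases c "0 :: real" rule: linorder_cases) (auto simp: power2_eq_square field_simps)
      ultimately show ?thesis by (simp only:)
    qed
    then have "(\<Sum>j\<in>insert 0 Basis. w j * (norm (y j - (x + v)))\<^sup>2)
        = (1 - \<tau>) * (norm v)\<^sup>2 + (\<Sum>e\<in>Basis. \<bar>v \<bullet> e\<bar> / s * (s\<^sup>2 + (norm v)\<^sup>2) - 2 * (v \<bullet> e)\<^sup>2)"
      unfolding split by (simp add: y_def)
    also have "\<dots> = (1 - \<tau>) * (norm v)\<^sup>2 + \<tau> * (s\<^sup>2 + (norm v)\<^sup>2) - 2 * (\<Sum>e\<in>Basis. (v \<bullet> e)\<^sup>2)"
      by (simp add: \<tau>_def sum_subtractf sum_distrib_left sum_distrib_right)
    also have "(\<Sum>e\<in>Basis. (v \<bullet> e)\<^sup>2) = (norm v)\<^sup>2"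
      using euclidean_inner [of v v] unfolding power2_norm_eq_inner by (simp add: power2_eq_square)
    finally have "(\<Sum>j\<in>insert 0 Basis. w j * (norm (y j - (x + v)))\<^sup>2) = \<tau> * s\<^sup>2 - (norm v)\<^sup>2"
      by (simp only: algebra_simps)
    then show ?thesis by (simp only: diff_le_eq) simp
  qed
  then have "\<kappa> * (\<Sum>j\<in>insert 0 Basis. w j * (norm (y j - (x + v)))\<^sup>2) \<le> \<kappa> * (\<tau> * s\<^sup>2)"
    using \<kappa> by (rule mult_left_mono)
  moreover have "(1 - \<tau>) * f x + (\<Sum>e\<in>Basis. \<bar>v \<bullet> e\<bar> / s * (f x + \<kappa> * s\<^sup>2) + (v \<bullet> e) * (g \<bullet> e)
        - norm v / s * D e) \<le> (\<Sum>j\<in>insert 0 Basis. w j * f (y j))"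
  proof -
    have "\<bar>v \<bullet> e\<bar> / s * (f x + \<kappa> * s\<^sup>2) + (v \<bullet> e) * (g \<bullet> e) - norm v / s * D e
        \<le> \<bar>v \<bullet> e\<bar> / s * f (y e)" if e: "e \<in> Basis" for e
    proof -
      have up: "f (x + s *\<^sub>R e) \<le> f x + s * (g \<bullet> e) + \<kappa> * s\<^sup>2"
           and dn: "f (x - s *\<^sub>R e) \<le> f x - s * (g \<bullet> e) + \<kappa> * s\<^sup>2"
        using g [of "x + s *\<^sub>R e"] g [of "x - s *\<^sub>R e"] star [OF e] s e by auto
      have D0: "D e \<ge> 0" using up dn by (simp add: D_def)
      have "\<bar>v \<bullet> e\<bar> / s * D e \<le> norm v / s * D e"
        using e s D0 by (intro mult_right_mono divide_right_mono Basis_le_norm) auto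
      moreover have "\<bar>v \<bullet> e\<bar> / s * (f x + \<kappa> * s\<^sup>2) + (v \<bullet> e) * (g \<bullet> e) - \<bar>v \<bullet> e\<bar> / s * D e
          \<le> \<bar>v \<bullet> e\<bar> / s * f (y e)"
      proof (cases "v \<bullet> e" "0 :: real" rule: linorder_cases)
        case less
        then have "(- (v \<bullet> e) / s) * (f x - s * (g \<bullet> e) + \<kappa> * s\<^sup>2 - D e) \<le> (- (v \<bullet> e) / s) * f (x - s *\<^sub>R e)"
          using up s by (intro mult_left_mono) (auto simp: D_def divide_le_0_iff)
        then show ?thesis using less s by (simp add: y_def sgn_if algebra_simps)
      next
        case greater
        then have "((v \<bullet> e) / s) * (f x + s * (g \<bullet> e) + \<kappa> * s\<^sup>2 - D e) \<le> ((v \<bullet> e) / s) * f (x + s *\<^sub>R e)"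
          using dn s by (intro mult_left_mono) (auto simp: D_def)
        then show ?thesis using greater s by (simp add: y_def sgn_if algebra_simps)
      qed simp
      ultimately show ?thesis by linarith
    qed
    then show ?thesis unfolding split by (auto intro!: sum_mono add_left_mono simp: y_def)
  qed
  moreover have "(\<Sum>e\<in>Basis. \<bar>v \<bullet> e\<bar> / s * (f x + \<kappa> * s\<^sup>2) + (v \<bullet> e) * (g \<bullet> e) - norm v / s * D e)
      = \<tau> * (f x + \<kappa> * s\<^sup>2) + g \<bullet> v - norm v / s * second_diff \<kappa> s f x"
  proof -
    have "second_diff \<kappa> s f x = sum D Basis" by (simp add: second_diff_def D_def)
    then show ?thesis
      by (simp add: sum_subtractf sum.distrib \<tau>_def sum_distrib_left sum_distrib_right sum_divide_distrib
          euclidean_inner [of g v] mult.commute)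
  qed
  ultimately show ?thesis by (simp add: algebra_simps)
qed

text \<open>Compare, at a point at distance \<open>\<eta>\<close> from \<open>x'\<close> in the direction of \<open>g - g'\<close>, the lower bound for \<open>f\<close>
  coming from \<open>g\<close> with the upper bound coming from \<open>g'\<close>.\<close>

lemma supergradients_close:
  fixes f :: "'a::euclidean_space \<Rightarrow> real" and \<eta> r :: real
  assumes sc: "semiconcave_on (ball a (2 * r)) \<kappa> f" and \<kappa>: "\<kappa> \<ge> 0"
    and \<eta>: "\<eta> > 0" "2 * real DIM('a) * \<eta> \<le> r"
    and x: "x \<in> ball a r" and x': "x' \<in> ball a r" and d: "norm (x' - x) \<le> \<eta>"
    and g: "\<And>z. z \<in> ball a (2 * r) \<Longrightarrow> f z \<le> f x + g \<bullet> (z - x) + \<kappa> * (norm (z - x))\<^sup>2"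
    and g': "\<And>z. z \<in> ball a (2 * r) \<Longrightarrow> f z \<le> f x' + g' \<bullet> (z - x') + \<kappa> * (norm (z - x'))\<^sup>2"
  shows "norm (g - g') \<le> second_diff \<kappa> (2 * real DIM('a) * \<eta>) f x / \<eta> + 2 * \<kappa> * \<eta>"
proof -
  define U where "U = ball a (2 * r)"
  define n where "n = real DIM('a)"
  define s where "s = 2 * n * \<eta>"
  have n: "n \<ge> 1" by (simp add: n_def Suc_leI)
  have s: "s > 0" "s \<le> r" "2 * \<eta> \<le> s"
    using \<eta> n mult_right_mono [of 1 n "2 * \<eta>"] by (auto simp: s_def n_def [symmetric] mult_ac)
  then have r: "r > 0" by linarith
  have near: "x + u \<in> U" if "norm u \<le> s" for u
    using norm_triangle_ineq4 [of "a - x" u] that x s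
    by (auto simp: U_def dist_norm algebra_simps)
  have star: "x + s *\<^sub>R e \<in> U \<and> x - s *\<^sub>R e \<in> U" if "e \<in> Basis" for e
    using near [of "s *\<^sub>R e"] near [of "- s *\<^sub>R e"] that s by auto
  have S0: "0 \<le> second_diff \<kappa> s f x"
    using second_diff_nonneg [OF sc [folded U_def], of x s] near [of 0] s star by auto
  \<comment> \<open>If \<open>g = g'\<close> then \<open>e = 0\<close>, for which the computation below remains valid.\<close>
  define e where "e = sgn (g - g')"
  define v where "v = x' - x + \<eta> *\<^sub>R e"
  have e: "norm e \<le> 1" "norm (g - g') = (g - g') \<bullet> e"
    unfolding e_def by (simp add: norm_sgn)
      (cases "g = g'"; simp add: sgn_div_norm power2_norm_eq_inner [symmetric] power2_eq_square)
  have v: "norm v \<le> 2 * \<eta>"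
  proof -
    have "\<eta> * norm e \<le> \<eta>" using mult_left_mono [OF e(1), of \<eta>] \<eta> by simp
    moreover have "norm v \<le> norm (x' - x) + \<eta> * norm e"
      using norm_triangle_ineq [of "x' - x" "\<eta> *\<^sub>R e"] \<eta> by (simp add: v_def)
    ultimately show ?thesis using d by linarith
  qed
  have xv: "x + v = x' + \<eta> *\<^sub>R e" by (simp add: v_def)
  have "f x + g \<bullet> v - norm v / s * second_diff \<kappa> s f x \<le> f (x + v)"
  proof (rule supergradient_lower_bound [where U = U])
    show "real DIM('a) * norm v \<le> s"
      using v n mult_left_mono [of "norm v" "2 * \<eta>" n] by (simp add: s_def n_def mult_ac)
    show "x + v \<in> U" "x \<in> U" using near [of v] near [of 0] v s by auto
  qed (use sc s star \<kappa> g in \<open>auto simp: U_def\<close>)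
  moreover have "norm v / s * second_diff \<kappa> s f x \<le> 1 * second_diff \<kappa> s f x"
    using v s S0 by (intro mult_right_mono) auto
  moreover have "f (x + v) \<le> f x' + g' \<bullet> (\<eta> *\<^sub>R e) + \<kappa> * (norm (\<eta> *\<^sub>R e))\<^sup>2"
    using g' [of "x + v"] near [of v] v s xv by (auto simp: U_def)
  moreover have "f x' \<le> f x + g \<bullet> (x' - x) + \<kappa> * (norm (x' - x))\<^sup>2"
    using g [of x'] x' r by auto
  moreover have "\<kappa> * (norm (\<eta> *\<^sub>R e))\<^sup>2 \<le> \<kappa> * \<eta>\<^sup>2" "\<kappa> * (norm (x' - x))\<^sup>2 \<le> \<kappa> * \<eta>\<^sup>2"
    using e \<eta> d \<kappa> mult_left_mono [OF e(1), of \<eta>] by (auto intro!: mult_left_mono power_mono)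
  ultimately have "\<eta> * ((g - g') \<bullet> e) \<le> second_diff \<kappa> s f x + 2 * \<kappa> * \<eta>\<^sup>2"
    by (simp add: v_def inner_add_right inner_diff_left algebra_simps)
  then show ?thesis using \<eta> e by (simp add: s_def n_def field_simps power2_eq_square)
qed

section \<open>Integrals of second differences\<close>

lemma power_diff_le:
  fixes u v :: real
  assumes "0 \<le> v" "v \<le> u"
  shows "u ^ n - v ^ n \<le> real n * u ^ (n - 1) * (u - v)"
proof (cases n)
  case (Suc m)
  have "u ^ n - v ^ n = (u - v) * (\<Sum>i<Suc m. v ^ (m - i) * u ^ i)"
    unfolding Suc using diff_power_eq_sum [of u m v] by (simp add: mult.commute)
  also have "\<dots> \<le> (u - v) * (\<Sum>i<Suc m. u ^ m)"
  proof (intro mult_left_mono sum_mono)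
    fix i assume "i \<in> {..<Suc m}"
    then have "v ^ (m - i) * u ^ i \<le> u ^ (m - i) * u ^ i"
      using assms by (intro mult_right_mono power_mono) auto
    also have "\<dots> = u ^ m" using \<open>i \<in> _\<close> by (simp flip: power_add)
    finally show "v ^ (m - i) * u ^ i \<le> u ^ m" .
  qed (use assms in auto)
  finally show ?thesis by (simp add: Suc mult_ac)
qed simp

lemma measure_annulus_le:
  fixes a :: "'a::euclidean_space"
  assumes "0 < s" "s \<le> r"
  shows "measure lborel (ball a (r + s) - ball a (r - s))
      \<le> 2 * s * DIM('a) * unit_ball_vol DIM('a) * (2 * r) ^ (DIM('a) - 1)"
proof -
  have "measure lborel (ball a (r + s) - ball a (r - s))
      = measure lborel (ball a (r + s)) - measure lborel (ball a (r - s))"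
    using assms by (intro measure_Diff) (auto simp: emeasure_ball subset_ball)
  also have "\<dots> = unit_ball_vol DIM('a) * ((r + s) ^ DIM('a) - (r - s) ^ DIM('a))"
    using assms by (simp add: content_ball algebra_simps)
  also have "\<dots> \<le> unit_ball_vol DIM('a) * (DIM('a) * (r + s) ^ (DIM('a) - 1) * ((r + s) - (r - s)))"
    using assms by (intro mult_left_mono power_diff_le) auto
  also have "\<dots> \<le> unit_ball_vol DIM('a) * (DIM('a) * (2 * r) ^ (DIM('a) - 1) * ((r + s) - (r - s)))"
    using assms by (intro mult_left_mono mult_right_mono power_mono) auto
  finally show ?thesis by (simp add: mult_ac)
qed

text \<open>With \<open>h x = f x - f (x - s e)\<close> the second difference is \<open>h x - h (x + s e)\<close>. Translating the second
  term, the integral over the ball becomes that of \<open>h\<close> against the difference of the indicators of the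
  ball and of its translate; this difference lives on an annulus of width \<open>2 s\<close>, where \<open>h\<close> is at most
  \<open>L s\<close>. Thus no second derivative of \<open>f\<close> is involved.\<close>

lemma integral_second_difference_le:
  fixes f :: "'a::euclidean_space \<Rightarrow> real" and s r L \<kappa> :: real
  assumes s: "0 < s" "s \<le> r" and L: "L \<ge> 0"
    and lip: "\<And>x y. x \<in> ball a (2 * r) \<Longrightarrow> y \<in> ball a (2 * r) \<Longrightarrow> \<bar>f x - f y\<bar> \<le> L * norm (x - y)"
    and e: "e \<in> Basis"
  shows "set_integrable lborel (ball a r) (\<lambda>x. 2 * f x - f (x + s *\<^sub>R e) - f (x - s *\<^sub>R e))" (is "?I")
    and "(LINT x:ball a r|lborel. 2 * f x - f (x + s *\<^sub>R e) - f (x - s *\<^sub>R e))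
      \<le> s\<^sup>2 * (2 * L * DIM('a) * unit_ball_vol DIM('a) * (2 * r) ^ (DIM('a) - 1))" (is "?B")
proof -
  define U where "U = ball a (2 * r)"
  \<comment> \<open>Cutting \<open>f\<close> off outside \<open>U\<close> makes it globally measurable and bounded.\<close>
  define F where "F x = indicator U x * f x" for x
  define h where "h x = F x - F (x - s *\<^sub>R e)" for x
  define C where "C = \<bar>f a\<bar> + L * (2 * r)"
  have FU: "F x = f x" if "x \<in> U" for x using that by (simp add: F_def)
  have cont: "continuous_on U f"
    unfolding continuous_on_iff
  proof (intro ballI allI impI)
    fix x \<epsilon> :: "_" assume "x \<in> U" "(\<epsilon>::real) > 0"
    then show "\<exists>d>0. \<forall>x'\<in>U. dist x' x < d \<longrightarrow> dist (f x') (f x) < \<epsilon>"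
    proof (intro exI conjI ballI impI)
      show "\<epsilon> / (L + 1) > 0" using \<open>\<epsilon> > 0\<close> L by simp
      fix x' assume "x' \<in> U" "dist x' x < \<epsilon> / (L + 1)"
      then have "(L + 1) * norm (x' - x) < \<epsilon>" using L by (simp add: dist_norm field_simps)
      moreover have "\<bar>f x' - f x\<bar> \<le> L * norm (x' - x)"
        using lip \<open>x \<in> U\<close> \<open>x' \<in> U\<close> by (auto simp: U_def)
      ultimately show "dist (f x') (f x) < \<epsilon>"
        using norm_ge_zero [of "x' - x"] unfolding dist_real_def distrib_right by linarith
    qed
  qed
  have F [measurable]: "F \<in> borel_measurable borel"
    using borel_measurable_continuous_on_indicator [OF _ cont] by (simp add: F_def [abs_def] U_def)
  have h [measurable]: "h \<in> borel_measurable borel" unfolding h_def by measurable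
  have FC: "\<bar>F x\<bar> \<le> C" for x
  proof (cases "x \<in> U")
    case True
    have "\<bar>f x - f a\<bar> \<le> L * norm (x - a)" using True s by (intro lip) (auto simp: U_def)
    also have "\<dots> \<le> L * (2 * r)"
      using True L by (intro mult_left_mono) (auto simp: U_def dist_norm norm_minus_commute)
    finally show ?thesis by (simp add: FU True C_def)
  qed (use L s in \<open>auto simp: F_def C_def\<close>)
  have hC: "\<bar>h x\<bar> \<le> 2 * C" for x
    using FC [of x] FC [of "x - s *\<^sub>R e"] by (simp add: h_def)
  have fin: "emeasure lborel (ball c t) < \<infinity>" for c :: 'a and t
    by (rule emeasure_lborel_ball_finite)
  have int: "integrable lborel (\<lambda>x. indicator (ball c r) x * h (x + w))" for c w :: 'a
    by (rule integrableI_bounded_set [where A = "ball c r" and B = "2 * C"])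
      (use fin hC in \<open>auto simp: indicator_def\<close>)
  have shift: "integral\<^sup>L lborel (\<lambda>x. indicator (ball a r) x * h (x + s *\<^sub>R e))
      = integral\<^sup>L lborel (\<lambda>x. indicator (ball (a + s *\<^sub>R e) r) x * h x)"
  proof -
    have "integral\<^sup>L lborel (\<lambda>x. indicator (ball (a + s *\<^sub>R e) r) x * h x)
        = integral\<^sup>L (distr lborel borel ((+) (s *\<^sub>R e))) (\<lambda>x. indicator (ball (a + s *\<^sub>R e) r) x * h x)"
      by (simp add: lborel_distr_plus)
    also have "\<dots> = integral\<^sup>L lborel (\<lambda>x. indicator (ball (a + s *\<^sub>R e) r) (s *\<^sub>R e + x) * h (s *\<^sub>R e + x))"
      by (rule integral_distr) (auto intro!: borel_measurable_times borel_measurable_indicator h)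
    finally show ?thesis
      by (simp add: add.commute indicator_def dist_norm)
  qed
  have eq: "indicator (ball a r) x *\<^sub>R (2 * f x - f (x + s *\<^sub>R e) - f (x - s *\<^sub>R e))
      = indicator (ball a r) x * h x - indicator (ball a r) x * h (x + s *\<^sub>R e)" for x
  proof (cases "x \<in> ball a r")
    case True
    then have "x \<in> U" "x + s *\<^sub>R e \<in> U" "x - s *\<^sub>R e \<in> U"
      using s e norm_triangle_ineq4 [of "a - x" "s *\<^sub>R e"] norm_triangle_ineq [of "a - x" "s *\<^sub>R e"]
      by (auto simp: U_def dist_norm algebra_simps)
    with True show ?thesis by (simp add: h_def FU)
  qed simp
  show ?I
    unfolding set_integrable_def eq using int [of a 0] int [of a "s *\<^sub>R e"] by simp
  have "(LINT x:ball a r|lborel. 2 * f x - f (x + s *\<^sub>R e) - f (x - s *\<^sub>R e))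
      = integral\<^sup>L lborel (\<lambda>x. indicator (ball a r) x * h x - indicator (ball (a + s *\<^sub>R e) r) x * h x)"
    unfolding set_lebesgue_integral_def eq
    using int [of a 0] int [of a "s *\<^sub>R e"] int [of "a + s *\<^sub>R e" 0] by (simp add: shift)
  also have "\<dots> \<le> integral\<^sup>L lborel (\<lambda>x. indicator (ball a (r + s) - ball a (r - s)) x * (L * s))"
  proof (rule integral_mono)
    have "emeasure lborel (ball a (r + s) - ball a (r - s)) < \<infinity>"
      by (rule le_less_trans [OF emeasure_mono fin]) auto
    then show "integrable lborel (\<lambda>x. indicator (ball a (r + s) - ball a (r - s)) x * (L * s))"
      by (auto intro!: integrable_mult_left)
    fix x
    have tri: "dist a (x - s *\<^sub>R e) \<le> dist a x + s" "dist a x \<le> dist a (x - s *\<^sub>R e) + s"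
      using s e dist_triangle [of a "x - s *\<^sub>R e" x] dist_triangle [of a x "x - s *\<^sub>R e"]
      by (auto simp: dist_norm)
    have mem: "x \<in> ball (a + s *\<^sub>R e) r \<longleftrightarrow> dist a (x - s *\<^sub>R e) < r"
      by (simp add: dist_norm algebra_simps)
    have "\<bar>h x\<bar> \<le> L * s" if "dist a x < 2 * r" "dist a (x - s *\<^sub>R e) < 2 * r"
      using lip [of x "x - s *\<^sub>R e"] that s e FU by (simp add: h_def U_def)
    then show "indicator (ball a r) x * h x - indicator (ball (a + s *\<^sub>R e) r) x * h x
        \<le> indicator (ball a (r + s) - ball a (r - s)) x * (L * s)"
      using tri s L unfolding indicator_def mem
      by (auto simp: mem_ball abs_le_iff)
  qed (use int [of a 0] int [of "a + s *\<^sub>R e" 0] in auto)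
  also have "\<dots> = L * s * measure lborel (ball a (r + s) - ball a (r - s))" by simp
  also have "\<dots> \<le> L * s * (2 * s * DIM('a) * unit_ball_vol DIM('a) * (2 * r) ^ (DIM('a) - 1))"
    using L s by (intro mult_left_mono measure_annulus_le) auto
  finally show ?B by (simp add: power2_eq_square mult_ac)
qed

lemma nn_integral_second_diff_le:
  fixes f :: "'a::euclidean_space \<Rightarrow> real" and s r L \<kappa> :: real
  assumes s: "0 < s" "s \<le> r" and L: "L \<ge> 0"
    and lip: "\<And>x y. x \<in> ball a (2 * r) \<Longrightarrow> y \<in> ball a (2 * r) \<Longrightarrow> \<bar>f x - f y\<bar> \<le> L * norm (x - y)"
    and nonneg: "\<And>x. x \<in> ball a r \<Longrightarrow> 0 \<le> second_diff \<kappa> s f x"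
  shows "(\<lambda>x. indicator (ball a r) x * second_diff \<kappa> s f x) \<in> borel_measurable borel" (is ?M)
    and "(\<integral>\<^sup>+x. ennreal (indicator (ball a r) x * second_diff \<kappa> s f x) \<partial>lborel)
      \<le> ennreal (s\<^sup>2 * (2 * DIM('a) * unit_ball_vol DIM('a)
           * (L * DIM('a) * (2 * r) ^ (DIM('a) - 1) + \<kappa> * r ^ DIM('a))))" (is ?B)
proof -
  define B where "B = ball a r"
  define D where "D e x = 2 * f x - f (x + s *\<^sub>R e) - f (x - s *\<^sub>R e)" for e x
  have D: "set_integrable lborel B (D e)"
      "(LINT x:B|lborel. D e x)
        \<le> s\<^sup>2 * (2 * L * DIM('a) * unit_ball_vol DIM('a) * (2 * r) ^ (DIM('a) - 1))"
    if "e \<in> Basis" for e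
    unfolding B_def D_def [abs_def]
    using integral_second_difference_le [of s r L a f e] s L lip that by blast+
  have c: "set_integrable lborel B (\<lambda>x. 2 * \<kappa> * s\<^sup>2)"
    unfolding B_def set_integrable_def using s by (auto simp: emeasure_ball intro!: integrable_mult_left)
  have int: "set_integrable lborel B (second_diff \<kappa> s f)"
    unfolding second_diff_def [abs_def] D_def [symmetric] set_integrable_def scaleR_sum_right
    by (intro Bochner_Integration.integrable_sum) (use set_integral_add(1) [OF D(1) c] in \<open>auto simp: set_integrable_def\<close>)
  have "(\<lambda>x. indicator B x * second_diff \<kappa> s f x) \<in> borel_measurable lborel"
    using borel_measurable_integrable [OF int [unfolded set_integrable_def]] by simp
  then show ?M by (simp add: B_def)
  have "(LINT x:B|lborel. second_diff \<kappa> s f x) = (\<Sum>e\<in>Basis. LINT x:B|lborel. D e x + 2 * \<kappa> * s\<^sup>2)"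
    unfolding second_diff_def D_def [symmetric] set_lebesgue_integral_def scaleR_sum_right
    by (intro Bochner_Integration.integral_sum)
      (use set_integral_add(1) [OF D(1) c] in \<open>auto simp: set_integrable_def\<close>)
  also have "\<dots> = (\<Sum>e\<in>Basis. (LINT x:B|lborel. D e x) + (LINT x:B|lborel. 2 * \<kappa> * s\<^sup>2))"
    by (intro sum.cong set_integral_add c D) auto
  also have "\<dots> \<le> (\<Sum>e\<in>(Basis::'a set). s\<^sup>2 * (2 * L * DIM('a) * unit_ball_vol DIM('a) * (2 * r) ^ (DIM('a) - 1))
       + 2 * \<kappa> * s\<^sup>2 * (unit_ball_vol DIM('a) * r ^ DIM('a)))"
    using s by (intro sum_mono add_mono D) (auto simp: B_def set_lebesgue_integral_def content_ball)
  also have "\<dots> = s\<^sup>2 * (2 * DIM('a) * unit_ball_vol DIM('a)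
           * (L * DIM('a) * (2 * r) ^ (DIM('a) - 1) + \<kappa> * r ^ DIM('a)))"
    by (simp add: algebra_simps)
  finally have le: "(LINT x:B|lborel. second_diff \<kappa> s f x) \<le> \<dots>" .
  have "(\<integral>\<^sup>+x. ennreal (indicator B x * second_diff \<kappa> s f x) \<partial>lborel)
      = ennreal (integral\<^sup>L lborel (\<lambda>x. indicator B x * second_diff \<kappa> s f x))"
    using int nonneg unfolding set_integrable_def
    by (intro nn_integral_eq_integral) (auto simp: B_def indicator_def)
  with le show ?B by (simp add: B_def set_lebesgue_integral_def ennreal_leI)
qed

section \<open>Differentiability of semiconcave functions\<close>

text \<open>The supergradient bounds \<open>f\<close> from above to first order, and \<open>supergradient_lower_bound\<close> bounds it
  from below with relative error \<open>second_diff \<kappa> s f x / s\<close>. One good step \<open>s\<close> for each \<open>\<epsilon>\<close> suffices,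
  as the lower bound holds on a whole ball.\<close>

lemma GDERIV_if_second_diff_small:
  fixes f :: "'a::euclidean_space \<Rightarrow> real"
  assumes sc: "semiconcave_on U \<kappa> f" and \<kappa>: "\<kappa> \<ge> 0" and U: "open U" "x \<in> U"
    and g: "\<And>z. z \<in> U \<Longrightarrow> f z \<le> f x + g \<bullet> (z - x) + \<kappa> * (norm (z - x))\<^sup>2"
    and small: "\<And>\<epsilon>. \<epsilon> > 0 \<Longrightarrow> \<exists>s>0. second_diff \<kappa> s f x \<le> \<epsilon> * s \<and>
                  (\<forall>e\<in>Basis. x + s *\<^sub>R e \<in> U \<and> x - s *\<^sub>R e \<in> U)"
  shows "GDERIV f x :> g"
  unfolding gderiv_def has_derivative_at_alt
proof (intro conjI allI impI)
  show "bounded_linear (\<lambda>h. h \<bullet> g)" by (rule bounded_linear_inner_left)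
  fix \<epsilon> :: real assume \<epsilon>: "\<epsilon> > 0"
  obtain s where s: "s > 0" "second_diff \<kappa> s f x \<le> \<epsilon> * s"
      "\<And>e. e \<in> Basis \<Longrightarrow> x + s *\<^sub>R e \<in> U \<and> x - s *\<^sub>R e \<in> U" using small [OF \<epsilon>] by blast
  obtain t where t: "t > 0" "ball x t \<subseteq> U" using U open_contains_ball by blast
  define \<delta> where "\<delta> = min t (min (s / DIM('a)) (\<epsilon> / (\<kappa> + 1)))"
  have \<delta>: "\<delta> > 0" using t s \<epsilon> \<kappa> by (auto simp: \<delta>_def)
  have "norm (f z - f x - (z - x) \<bullet> g) \<le> \<epsilon> * norm (z - x)" if z: "norm (z - x) < \<delta>" for z
  proof -
    have zU: "z \<in> U" using z t by (auto simp: \<delta>_def dist_norm norm_minus_commute)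
    have n: "DIM('a) * norm (z - x) \<le> s" using z by (auto simp: \<delta>_def field_simps)
    have "(\<kappa> + 1) * norm (z - x) \<le> \<epsilon>" using z \<kappa> by (auto simp: \<delta>_def field_simps)
    then have "\<kappa> * norm (z - x) \<le> \<epsilon>" by (simp add: algebra_simps) (use norm_ge_zero [of "z - x"] in linarith)
    then have "\<kappa> * (norm (z - x))\<^sup>2 \<le> \<epsilon> * norm (z - x)"
      using mult_right_mono [of "\<kappa> * norm (z - x)" \<epsilon> "norm (z - x)"] by (simp add: power2_eq_square mult_ac)
    with g [OF zU] have up: "f z - f x - g \<bullet> (z - x) \<le> \<epsilon> * norm (z - x)" by simp
    have "f x + g \<bullet> (z - x) - norm (z - x) / s * second_diff \<kappa> s f x \<le> f (x + (z - x))"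
      by (rule supergradient_lower_bound [OF sc]) (use s U zU n \<kappa> g in auto)
    moreover have "norm (z - x) / s * second_diff \<kappa> s f x \<le> norm (z - x) / s * (\<epsilon> * s)"
      using s by (intro mult_left_mono) auto
    ultimately show ?thesis using up s by (simp add: inner_commute mult.commute abs_le_iff)
  qed
  then show "\<exists>d>0. \<forall>y. norm (y - x) < d \<longrightarrow> norm (f y - f x - (y - x) \<bullet> g) \<le> \<epsilon> * norm (y - x)"
    using \<delta> by blast
qed

text \<open>The integral of \<open>second_diff \<kappa> s f / s\<close> is \<open>O(s)\<close>, so by Fatou's lemma its lower limit along
  \<open>s = r / n\<close> vanishes almost everywhere. This takes the place of the theorems of Rademacher and
  Alexandrov.\<close>

lemma AE_GDERIV_semiconcave:
  fixes f :: "'a::euclidean_space \<Rightarrow> real" and r \<kappa> L :: real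
  assumes r: "r > 0" and \<kappa>: "\<kappa> \<ge> 0" and L: "L \<ge> 0"
    and sc: "semiconcave_on (ball a (2 * r)) \<kappa> f"
    and lip: "\<And>x y. x \<in> ball a (2 * r) \<Longrightarrow> y \<in> ball a (2 * r) \<Longrightarrow> \<bar>f x - f y\<bar> \<le> L * norm (x - y)"
    and g: "\<And>x. x \<in> ball a r \<Longrightarrow>
       \<exists>g. \<forall>z\<in>ball a (2 * r). f z \<le> f x + g \<bullet> (z - x) + \<kappa> * (norm (z - x))\<^sup>2"
  shows "AE x in lborel. x \<in> ball a r \<longrightarrow> (\<exists>g. GDERIV f x :> g)"
proof -
  define s where "s n = r / real (Suc n)" for n
  define C where "C = 2 * DIM('a) * unit_ball_vol DIM('a)
           * (L * DIM('a) * (2 * r) ^ (DIM('a) - 1) + \<kappa> * r ^ DIM('a))"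
  define F where "F n x = indicator (ball a r) x * second_diff \<kappa> (s n) f x" for n x
  have s: "s n > 0" "s n \<le> r" for n
    using r by (auto simp: s_def field_simps)
  have C: "C \<ge> 0" using \<kappa> L r by (auto simp: C_def)
  have star: "x + s n *\<^sub>R e \<in> ball a (2 * r) \<and> x - s n *\<^sub>R e \<in> ball a (2 * r)"
    if "x \<in> ball a r" "e \<in> Basis" for x e n
    using that s [of n] norm_triangle_ineq4 [of "a - x" "s n *\<^sub>R e"] norm_triangle_ineq [of "a - x" "s n *\<^sub>R e"]
    by (auto simp: dist_norm algebra_simps)
  have nonneg: "0 \<le> second_diff \<kappa> (s n) f x" if "x \<in> ball a r" for x n
    using second_diff_nonneg [OF sc _ star] that r by auto
  have F: "F n \<in> borel_measurable borel"
      "(\<integral>\<^sup>+x. ennreal (F n x) \<partial>lborel) \<le> ennreal ((s n)\<^sup>2 * C)" for n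
    using nn_integral_second_diff_le [OF s L, of a f \<kappa> n] lip nonneg unfolding F_def [abs_def] C_def by blast+
  have "(\<integral>\<^sup>+x. ennreal (F n x / s n) \<partial>lborel) \<le> ennreal (s n * C)" for n
  proof -
    have "(\<integral>\<^sup>+x. ennreal (F n x / s n) \<partial>lborel) = (\<integral>\<^sup>+x. ennreal (1 / s n) * ennreal (F n x) \<partial>lborel)"
      using s [of n] by (intro nn_integral_cong) (simp flip: ennreal_mult')
    also have "\<dots> = ennreal (1 / s n) * (\<integral>\<^sup>+x. ennreal (F n x) \<partial>lborel)"
      using F(1) [of n] by (intro nn_integral_cmult) auto
    also have "\<dots> \<le> ennreal (1 / s n) * ennreal ((s n)\<^sup>2 * C)"
      by (intro mult_left_mono F) auto
    also have "\<dots> = ennreal (s n * C)"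
      using s [of n] by (simp add: power2_eq_square flip: ennreal_mult')
    finally show ?thesis .
  qed
  then have "liminf (\<lambda>n. \<integral>\<^sup>+x. ennreal (F n x / s n) \<partial>lborel) \<le> liminf (\<lambda>n. ennreal (s n * C))"
    by (intro Liminf_mono) auto
  also have "\<dots> = 0"
  proof (rule lim_imp_Liminf)
    have "(\<lambda>n. s n * C) \<longlonglongrightarrow> 0 * C"
      unfolding s_def by (intro tendsto_intros LIMSEQ_Suc lim_const_over_n)
    then show "(\<lambda>n. ennreal (s n * C)) \<longlonglongrightarrow> 0"
      using tendsto_ennrealI by fastforce
  qed simp
  finally have "(\<integral>\<^sup>+x. liminf (\<lambda>n. ennreal (F n x / s n)) \<partial>lborel) = 0"
    using nn_integral_liminf [of "\<lambda>n x. ennreal (F n x / s n)" lborel] F(1) by auto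
  then have "AE x in lborel. liminf (\<lambda>n. ennreal (F n x / s n)) = 0"
    using F(1) by (subst (asm) nn_integral_0_iff_AE) auto
  then show ?thesis
  proof eventually_elim
    fix x assume lim: "liminf (\<lambda>n. ennreal (F n x / s n)) = 0"
    show "x \<in> ball a r \<longrightarrow> (\<exists>g. GDERIV f x :> g)"
    proof
      assume x: "x \<in> ball a r"
      then obtain g where g: "\<And>z. z \<in> ball a (2 * r) \<Longrightarrow> f z \<le> f x + g \<bullet> (z - x) + \<kappa> * (norm (z - x))\<^sup>2"
        using g by blast
      have "GDERIV f x :> g"
      proof (rule GDERIV_if_second_diff_small [OF sc \<kappa> _ _ g])
        fix \<epsilon> :: real assume \<epsilon>: "\<epsilon> > 0"
        have "\<exists>n. ennreal (F n x / s n) < ennreal \<epsilon>"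
        proof (rule ccontr)
          assume "\<not> ?thesis"
          then have "ennreal \<epsilon> \<le> liminf (\<lambda>n. ennreal (F n x / s n))"
            by (intro Liminf_bounded) (auto simp: not_less)
          with lim \<epsilon> show False by simp
        qed
        then obtain n where "ennreal (F n x / s n) < ennreal \<epsilon>" ..
        moreover have "F n x / s n \<ge> 0" using nonneg [OF x, of n] s [of n] by (simp add: F_def x)
        ultimately have "F n x / s n < \<epsilon>" by (simp add: ennreal_less_iff)
        then have "second_diff \<kappa> (s n) f x \<le> \<epsilon> * s n"
          using x s [of n] by (simp add: F_def field_simps)
        then show "\<exists>s>0. second_diff \<kappa> s f x \<le> \<epsilon> * s \<and>
            (\<forall>e\<in>Basis. x + s *\<^sub>R e \<in> ball a (2 * r) \<and> x - s *\<^sub>R e \<in> ball a (2 * r))"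
          using s [of n] star [OF x] by blast
      qed (use x r in auto)
      then show "\<exists>g. GDERIV f x :> g" ..
    qed
  qed
qed

text \<open>Test the upper bound at \<open>x + t (g - G)\<close> for small positive \<open>t\<close>.\<close>

lemma GDERIV_eq_supergradient:
  fixes f :: "'a::euclidean_space \<Rightarrow> real"
  assumes der: "GDERIV f x :> g" and U: "open U" "x \<in> U" and \<kappa>: "\<kappa> \<ge> 0"
    and G: "\<And>z. z \<in> U \<Longrightarrow> f z \<le> f x + G \<bullet> (z - x) + \<kappa> * (norm (z - x))\<^sup>2"
  shows "g = G"
proof (rule ccontr)
  assume "g \<noteq> G"
  define h where "h = g - G"
  define n where "n = norm h"
  have n: "n > 0" using \<open>g \<noteq> G\<close> by (simp add: n_def h_def)
  have "n / 4 > 0" using n by simp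
  then obtain d where d: "d > 0"
      "\<And>y. norm (y - x) < d \<Longrightarrow> norm (f y - f x - (y - x) \<bullet> g) \<le> n / 4 * norm (y - x)"
    using der unfolding gderiv_def has_derivative_at_alt by blast
  obtain b where b: "b > 0" "ball x b \<subseteq> U" using U open_contains_ball by blast
  define t where "t = min (min d b / (2 * n)) (1 / (4 * (\<kappa> + 1)))"
  have t: "t > 0" "t * n < d" "t * n < b" "\<kappa> * t \<le> 1 / 4"
  proof -
    show "t > 0" using d b n \<kappa> by (simp add: t_def)
    have "t * n \<le> min d b / (2 * n) * n" using n by (intro mult_right_mono) (auto simp: t_def)
    also have "\<dots> = min d b / 2" using n by simp
    finally show "t * n < d" "t * n < b" using d b by auto
    have "\<kappa> * t \<le> \<kappa> * (1 / (4 * (\<kappa> + 1)))" using \<kappa> by (intro mult_left_mono) (auto simp: t_def)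
    also have "\<dots> \<le> 1 / 4" using \<kappa> by (simp add: field_simps)
    finally show "\<kappa> * t \<le> 1 / 4" .
  qed
  have nt: "norm (t *\<^sub>R h) = t * n" using t by (simp add: n_def)
  have "f (x + t *\<^sub>R h) \<le> f x + G \<bullet> (t *\<^sub>R h) + \<kappa> * (t * n)\<^sup>2"
    using G [of "x + t *\<^sub>R h"] b t nt by (auto simp: dist_norm subset_iff)
  moreover have "\<bar>f (x + t *\<^sub>R h) - f x - (t *\<^sub>R h) \<bullet> g\<bar> \<le> n / 4 * (t * n)"
    using d(2) [of "x + t *\<^sub>R h"] t nt by simp
  moreover have "t * ((g - G) \<bullet> h) = (t *\<^sub>R h) \<bullet> g - G \<bullet> (t *\<^sub>R h)"
    by (simp add: inner_diff_left inner_commute [of g h] right_diff_distrib)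
  ultimately have "t * ((g - G) \<bullet> h) \<le> n / 4 * (t * n) + \<kappa> * (t * n)\<^sup>2"
    by linarith
  also have "(g - G) \<bullet> h = n * n" by (simp add: n_def h_def dot_square_norm power2_eq_square)
  also have "\<kappa> * (t * n)\<^sup>2 = (\<kappa> * t) * (t * (n * n))" by (simp add: power2_eq_square)
  also have "\<dots> \<le> 1 / 4 * (t * (n * n))" using t n by (intro mult_right_mono) auto
  finally have "t * (n * n) \<le> 1 / 2 * (t * (n * n))" by simp
  moreover have "t * (n * n) > 0" using t n by simp
  ultimately show False by linarith
qed

section \<open>Potentials that are concave for the cost\<close>

text \<open>This form over the reals removes the extended-real transforms from the rest of the argument.\<close>

lemma c_superdifferential_iff:
  "(x, y) \<in> c_superdifferential \<Omega> c \<phi> \<longleftrightarrow>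
     x \<in> \<Omega> \<and> y \<in> \<Omega> \<and> (\<forall>x'\<in>\<Omega>. \<phi> x' \<le> \<phi> x + c x' y - c x y)"
proof -
  have "ereal (\<phi> x) + c_transform \<Omega> c \<phi> y = ereal (c x y) \<longleftrightarrow>
      (\<forall>x'\<in>\<Omega>. \<phi> x' \<le> \<phi> x + c x' y - c x y)" if x: "x \<in> \<Omega>"
  proof
    assume eq: "ereal (\<phi> x) + c_transform \<Omega> c \<phi> y = ereal (c x y)"
    then have "c_transform \<Omega> c \<phi> y = ereal (c x y - \<phi> x)"
      by (cases "c_transform \<Omega> c \<phi> y") auto
    moreover have "c_transform \<Omega> c \<phi> y \<le> ereal (c x' y - \<phi> x')" if "x' \<in> \<Omega>" for x'
      unfolding c_transform_def using that by (rule INF_lower)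
    ultimately show "\<forall>x'\<in>\<Omega>. \<phi> x' \<le> \<phi> x + c x' y - c x y"
      by (fastforce simp: algebra_simps)
  next
    assume *: "\<forall>x'\<in>\<Omega>. \<phi> x' \<le> \<phi> x + c x' y - c x y"
    have "c_transform \<Omega> c \<phi> y = ereal (c x y - \<phi> x)"
      unfolding c_transform_def
      by (rule antisym, rule INF_lower [OF x], rule INF_greatest) (use * in \<open>auto simp: algebra_simps\<close>)
    then show "ereal (\<phi> x) + c_transform \<Omega> c \<phi> y = ereal (c x y)" by simp
  qed
  then show ?thesis by (auto simp: c_superdifferential_def)
qed

lemma c_concave_almost_attained:
  assumes "ereal (\<phi> x) = cbar_transform c (c_transform \<Omega> c \<phi>) x" and "\<epsilon> > 0"
  shows "\<exists>y. \<forall>x'\<in>\<Omega>. \<phi> x' \<le> \<phi> x + c x' y - c x y + \<epsilon>"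
proof -
  have "(INF y. ereal (c x y) - c_transform \<Omega> c \<phi> y) < ereal (\<phi> x + \<epsilon>)"
    using \<open>\<epsilon> > 0\<close> by (simp add: cbar_transform_def [symmetric] assms(1) [symmetric])
  then obtain y where y: "ereal (c x y) - c_transform \<Omega> c \<phi> y < ereal (\<phi> x + \<epsilon>)"
    by (auto simp: INF_less_iff)
  have "\<phi> x' \<le> \<phi> x + c x' y - c x y + \<epsilon>" if "x' \<in> \<Omega>" for x'
  proof -
    have "c_transform \<Omega> c \<phi> y \<le> ereal (c x' y - \<phi> x')"
      unfolding c_transform_def using that by (rule INF_lower)
    with y show ?thesis by (cases "c_transform \<Omega> c \<phi> y") auto
  qed
  then show ?thesis by blast
qed

text \<open>Moving \<open>x\<close> towards a far away \<open>y\<close> by \<open>\<delta>\<close> decreases the cost by at least \<open>\<delta>\<close> times the distance, whereas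
  \<open>\<phi>\<close> can change by at most \<open>2 m\<close>.\<close>

lemma almost_minimiser_bounded:
  fixes x y :: "'a::euclidean_space"
  assumes p: "p \<ge> 2" and \<delta>: "\<delta> > 0" and sub: "cball x \<delta> \<subseteq> \<Omega>"
    and m: "\<And>z. z \<in> cball x \<delta> \<Longrightarrow> \<bar>\<phi> z\<bar> \<le> m"
    and y: "\<forall>x'\<in>\<Omega>. \<phi> x' \<le> \<phi> x + p_cost p x' y - p_cost p x y + 1"
  shows "norm (x - y) \<le> 1 + \<delta> + (2 * m + 1) / \<delta>"
proof (cases "norm (x - y) \<le> 1 + \<delta>")
  case True
  have "m \<ge> 0" using m [of x] \<delta> by simp
  then show ?thesis using True \<delta> by (simp add: add_increasing2)
next
  case False
  define D where "D = norm (x - y)"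
  \<comment> \<open>The point at distance \<open>\<delta>\<close> from \<open>x\<close> on the segment towards \<open>y\<close>.\<close>
  define x' where "x' = x + (\<delta> / D) *\<^sub>R (y - x)"
  have D: "D > 1" "D > \<delta>" using False \<delta> by (auto simp: D_def)
  have "norm (x' - x) = \<bar>\<delta> / D\<bar> * D" by (simp add: x'_def D_def norm_minus_commute)
  then have "norm (x' - x) = \<delta>" using D \<delta> by simp
  then have x': "x' \<in> cball x \<delta>" by (simp add: dist_norm norm_minus_commute)
  have "x' - y = (1 - \<delta> / D) *\<^sub>R (x - y)" by (simp add: x'_def algebra_simps)
  then have "norm (x' - y) = \<bar>1 - \<delta> / D\<bar> * D" by (simp add: D_def)
  moreover have "\<delta> / D \<le> 1" using D \<delta> by simp
  ultimately have xy: "norm (x' - y) = D - \<delta>" using D by (simp add: left_diff_distrib)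
  have Dp: "t powr p = t powr (p - 1) * t" if "t > 0" for t
    using that powr_add [of t "p - 1" 1] by simp
  have "(D - \<delta>) powr (p - 1) * (D - \<delta>) \<le> D powr (p - 1) * (D - \<delta>)"
    using D \<delta> p by (intro mult_right_mono powr_mono2) auto
  then have "D powr p - (D - \<delta>) powr p \<ge> D powr (p - 1) * \<delta>"
    using D Dp [of D] Dp [of "D - \<delta>"] by (simp add: algebra_simps)
  moreover have "D powr 1 * \<delta> \<le> D powr (p - 1) * \<delta>"
    using D \<delta> p by (intro mult_right_mono powr_mono) auto
  moreover have "\<phi> x' \<le> \<phi> x + (D - \<delta>) powr p - D powr p + 1"
  proof -
    have "x' \<in> \<Omega>" using x' sub by blast
    with y have "\<phi> x' \<le> \<phi> x + p_cost p x' y - p_cost p x y + 1" by blast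
    then show ?thesis by (simp add: p_cost_def xi_def xy flip: D_def)
  qed
  moreover have "\<bar>\<phi> x'\<bar> \<le> m" "\<bar>\<phi> x\<bar> \<le> m" using m [of x'] m [of x] x' \<delta> by auto
  ultimately have "D * \<delta> \<le> 2 * m + 1" using D by simp
  then have "D \<le> (2 * m + 1) / \<delta>" using \<delta> by (simp add: field_simps)
  then show ?thesis using \<delta> by (simp add: D_def)
qed

text \<open>Minimising sequences are bounded by the previous lemma, and the inequality that characterises the
  superdifferential passes to limits in \<open>y\<close>. The limit is a point of the whole space; only at
  points of differentiability will it be identified with a point of \<open>\<Omega>\<close>.\<close>

lemma c_concave_attained:
  fixes \<phi> :: "'a::euclidean_space \<Rightarrow> real"
  assumes p: "p \<ge> 2" and \<Omega>: "open \<Omega>" and cont: "continuous_on \<Omega> \<phi>" and x: "x \<in> \<Omega>"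
    and conc: "ereal (\<phi> x) = cbar_transform (p_cost p) (c_transform \<Omega> (p_cost p) \<phi>) x"
  shows "\<exists>y. \<forall>x'\<in>\<Omega>. \<phi> x' \<le> \<phi> x + p_cost p x' y - p_cost p x y"
proof -
  have "\<exists>y. \<forall>x'\<in>\<Omega>. \<phi> x' \<le> \<phi> x + p_cost p x' y - p_cost p x y + 1 / real (Suc n)" for n
    by (rule c_concave_almost_attained [OF conc]) simp
  then obtain Y where Y: "\<And>n x'. x' \<in> \<Omega> \<Longrightarrow> \<phi> x' \<le> \<phi> x + p_cost p x' (Y n) - p_cost p x (Y n) + 1 / real (Suc n)"
    by metis
  obtain \<delta> where \<delta>: "\<delta> > 0" "cball x \<delta> \<subseteq> \<Omega>" using \<Omega> x open_contains_cball by blast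
  have "compact (\<phi> ` cball x \<delta>)"
    using \<delta> cont by (intro compact_continuous_image) (auto intro: continuous_on_subset)
  then obtain m where m: "\<And>z. z \<in> cball x \<delta> \<Longrightarrow> \<bar>\<phi> z\<bar> \<le> m"
    using compact_imp_bounded bounded_iff by (metis imageI real_norm_def)
  have "Y n \<in> cball x (1 + \<delta> + (2 * m + 1) / \<delta>)" for n
  proof -
    have "1 / real (Suc n) \<le> 1" by simp
    then have "\<phi> x' \<le> \<phi> x + p_cost p x' (Y n) - p_cost p x (Y n) + 1" if "x' \<in> \<Omega>" for x'
      using Y [OF that, of n] by linarith
    then have "\<forall>x'\<in>\<Omega>. \<phi> x' \<le> \<phi> x + p_cost p x' (Y n) - p_cost p x (Y n) + 1" by blast
    from almost_minimiser_bounded [OF p \<delta> m this] show ?thesis by (simp add: dist_norm)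
  qed
  moreover have "compact (cball x (1 + \<delta> + (2 * m + 1) / \<delta>))" by simp
  ultimately obtain y k where k: "strict_mono k" "(Y \<circ> k) \<longlonglongrightarrow> y"
    unfolding compact_def by meson
  have "\<phi> x' \<le> \<phi> x + p_cost p x' y - p_cost p x y" if "x' \<in> \<Omega>" for x'
  proof (rule LIMSEQ_le_const)
    have cc: "(\<lambda>n. p_cost p u ((Y \<circ> k) n)) \<longlonglongrightarrow> p_cost p u y" for u
      using continuous_on_p_cost [OF p, of u] k(2)
      by (intro isCont_tendsto_compose [of y "p_cost p u"]) (simp_all add: continuous_on_eq_continuous_at o_def)
    have inv: "(\<lambda>n. 1 / real (Suc (k n))) \<longlonglongrightarrow> 0"
      using LIMSEQ_subseq_LIMSEQ [OF LIMSEQ_Suc [OF lim_const_over_n [of 1]] k(1)] by (simp add: o_def)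
    show "(\<lambda>n. \<phi> x + p_cost p x' ((Y \<circ> k) n) - p_cost p x ((Y \<circ> k) n) + 1 / real (Suc (k n)))
        \<longlonglongrightarrow> \<phi> x + p_cost p x' y - p_cost p x y"
      using tendsto_add [OF tendsto_diff [OF tendsto_add [OF tendsto_const cc] cc] inv] by simp
    show "\<exists>N. \<forall>n\<ge>N. \<phi> x' \<le> \<phi> x + p_cost p x' ((Y \<circ> k) n) - p_cost p x ((Y \<circ> k) n) + 1 / real (Suc (k n))"
      using Y [OF that] by (auto simp: o_def)
  qed
  then show ?thesis by blast
qed

text \<open>Near each point the minimisers \<open>y\<close> stay in a bounded set, hence \<open>\<phi>\<close> is locally semiconcave and
  Lipschitz. A countable family of the small balls covers \<open>\<Omega>\<close>.\<close>

lemma AE_GDERIV_c_concave: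
  fixes \<phi> :: "'a::euclidean_space \<Rightarrow> real"
  assumes p: "p \<ge> 2" and \<Omega>: "open \<Omega>" and cont: "continuous_on \<Omega> \<phi>"
    and conc: "\<forall>x\<in>\<Omega>. ereal (\<phi> x) = cbar_transform (p_cost p) (c_transform \<Omega> (p_cost p) \<phi>) x"
  shows "AE x in lborel. x \<in> \<Omega> \<longrightarrow> (\<exists>g. GDERIV \<phi> x :> g)"
proof -
  have local: "\<exists>r>0. AE x in lborel. x \<in> ball a r \<longrightarrow> (\<exists>g. GDERIV \<phi> x :> g)" if a: "a \<in> \<Omega>" for a
  proof -
    obtain \<delta>' where "\<delta>' > 0" "cball a \<delta>' \<subseteq> \<Omega>" using \<Omega> a open_contains_cball by blast
    then obtain \<delta> where \<delta>: "\<delta> > 0" "cball a (2 * \<delta>) \<subseteq> \<Omega>"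
      by (metis field_sum_of_halves half_gt_zero mult_2)
    define U where "U = ball a (2 * (\<delta> / 2))"
    have "compact (\<phi> ` cball a (2 * \<delta>))"
      using \<delta> cont by (intro compact_continuous_image) (auto intro: continuous_on_subset)
    then obtain m where m: "\<And>z. z \<in> cball a (2 * \<delta>) \<Longrightarrow> \<bar>\<phi> z\<bar> \<le> m"
      using compact_imp_bounded bounded_iff by (metis imageI real_norm_def)
    define K where "K = 1 + 3 * \<delta> + (2 * m + 1) / \<delta>"
    have sub: "cball x \<delta> \<subseteq> cball a (2 * \<delta>)" if "x \<in> U" for x
    proof
      fix z assume "z \<in> cball x \<delta>"
      then show "z \<in> cball a (2 * \<delta>)" using that dist_triangle [of a z x] by (simp add: U_def)
    qed
    have U: "U \<subseteq> \<Omega>" using sub \<delta> by force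
    have ex: "\<exists>y. (\<forall>z\<in>\<Omega>. \<phi> z \<le> \<phi> x + p_cost p z y - p_cost p x y) \<and> (\<forall>z\<in>U. norm (z - y) \<le> K)"
      if x: "x \<in> U" for x
    proof -
      obtain y where y: "\<forall>z\<in>\<Omega>. \<phi> z \<le> \<phi> x + p_cost p z y - p_cost p x y"
        using c_concave_attained [OF p \<Omega> cont, of x] conc x U by blast
      have "norm (x - y) \<le> 1 + \<delta> + (2 * m + 1) / \<delta>"
      proof (rule almost_minimiser_bounded [OF p \<delta>(1)])
        show "cball x \<delta> \<subseteq> \<Omega>" using sub [OF x] \<delta> by blast
        show "\<bar>\<phi> z\<bar> \<le> m" if "z \<in> cball x \<delta>" for z using sub [OF x] m that by blast
        show "\<forall>z\<in>\<Omega>. \<phi> z \<le> \<phi> x + p_cost p z y - p_cost p x y + 1" using y by force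
      qed
      moreover have "norm (z - x) \<le> 2 * \<delta>" if "z \<in> U" for z
        using x that dist_triangle2 [of z x a] by (auto simp: U_def dist_norm norm_minus_commute)
      ultimately have "norm (z - y) \<le> K" if "z \<in> U" for z
        using that norm_triangle_ineq [of "z - x" "x - y"] by (force simp: K_def)
      with y show ?thesis by blast
    qed
    define \<kappa> where "\<kappa> = p * (p - 1) * K powr (p - 2)"
    define L where "L = p * K powr (p - 1)"
    have super: "\<exists>g. \<forall>z\<in>U. \<phi> z \<le> \<phi> x + g \<bullet> (z - x) + \<kappa> * (norm (z - x))\<^sup>2" if x: "x \<in> U" for x
    proof -
      obtain y where y: "\<And>z. z \<in> \<Omega> \<Longrightarrow> \<phi> z \<le> \<phi> x + p_cost p z y - p_cost p x y"
          "\<And>z. z \<in> U \<Longrightarrow> norm (z - y) \<le> K" using ex [OF x] by blast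
      have "\<phi> z \<le> \<phi> x + grad_xi p (x - y) \<bullet> (z - x) + \<kappa> * (norm (z - x))\<^sup>2" if "z \<in> U" for z
        using y(1) [of z] p_cost_upper_quadratic [OF p y(2) [OF x] y(2) [OF that]] that U
        by (force simp: \<kappa>_def)
      then show ?thesis by blast
    qed
    have lip1: "\<phi> z - \<phi> x \<le> L * norm (z - x)" if xz: "x \<in> U" "z \<in> U" for x z
    proof -
      obtain y where y: "\<And>z. z \<in> \<Omega> \<Longrightarrow> \<phi> z \<le> \<phi> x + p_cost p z y - p_cost p x y"
          "\<And>z. z \<in> U \<Longrightarrow> norm (z - y) \<le> K" using ex [OF xz(1)] by blast
      have "z \<in> \<Omega>" using U xz by blast
      then show ?thesis
        using y(1) [of z] p_cost_lipschitz [OF p y(2) [OF xz(2)], of x] by (simp add: L_def)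
    qed
    have "AE x in lborel. x \<in> ball a (\<delta> / 2) \<longrightarrow> (\<exists>g. GDERIV \<phi> x :> g)"
    proof (rule AE_GDERIV_semiconcave [where \<kappa> = \<kappa> and L = L])
      show "semiconcave_on (ball a (2 * (\<delta> / 2))) \<kappa> \<phi>"
        unfolding semiconcave_on_def U_def [symmetric] using super by (meson le_add_same_cancel1 less_imp_le order_trans)
      show "\<bar>\<phi> x - \<phi> y\<bar> \<le> L * norm (x - y)" if "x \<in> ball a (2 * (\<delta> / 2))" "y \<in> ball a (2 * (\<delta> / 2))" for x y
        using lip1 [of x y] lip1 [of y x] that
        unfolding U_def [symmetric] by (simp add: abs_le_iff norm_minus_commute)
      show "\<exists>g. \<forall>z\<in>ball a (2 * (\<delta> / 2)). \<phi> z \<le> \<phi> x + g \<bullet> (z - x) + \<kappa> * (norm (z - x))\<^sup>2"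
        if "x \<in> ball a (\<delta> / 2)" for x
        using super [of x] that \<delta> unfolding U_def by auto
    qed (use p \<delta> in \<open>auto simp: \<kappa>_def L_def\<close>)
    with \<delta> show ?thesis by (intro exI [of _ "\<delta> / 2"]) auto
  qed
  then obtain r where r: "\<And>a. a \<in> \<Omega> \<Longrightarrow> r a > 0 \<and> (AE x in lborel. x \<in> ball a (r a) \<longrightarrow> (\<exists>g. GDERIV \<phi> x :> g))"
    by metis
  obtain \<F>' where \<F>': "\<F>' \<subseteq> (\<lambda>a. ball a (r a)) ` \<Omega>" "countable \<F>'"
      "\<Union>\<F>' = \<Union>((\<lambda>a. ball a (r a)) ` \<Omega>)"
    using Lindelof [of "(\<lambda>a. ball a (r a)) ` \<Omega>"] by blast
  have "AE x in lborel. \<forall>B\<in>\<F>'. x \<in> B \<longrightarrow> (\<exists>g. GDERIV \<phi> x :> g)"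
    using \<F>' r by (subst AE_ball_countable) auto
  then show ?thesis
  proof eventually_elim
    fix x assume *: "\<forall>B\<in>\<F>'. x \<in> B \<longrightarrow> (\<exists>g. GDERIV \<phi> x :> g)"
    show "x \<in> \<Omega> \<longrightarrow> (\<exists>g. GDERIV \<phi> x :> g)"
    proof
      assume "x \<in> \<Omega>"
      then have "x \<in> \<Union>\<F>'" using r \<F>'(3) by (auto intro!: bexI [of _ x])
      with * show "\<exists>g. GDERIV \<phi> x :> g" by blast
    qed
  qed
qed

text \<open>At a point of differentiability the gradient of \<open>\<phi>\<close> is the only supergradient, so a minimising \<open>y\<close>
  satisfies \<open>\<nabla>\<phi> x = \<nabla>\<xi> (x - y)\<close>; injectivity of \<open>\<nabla>\<xi>\<close> identifies \<open>y\<close> with \<open>T x\<close>.\<close>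

lemma AE_ot_map_in_c_superdifferential:
  fixes \<phi> :: "'a::euclidean_space \<Rightarrow> real"
  assumes p: "p \<ge> 2" and \<Omega>: "open \<Omega>" and cont: "continuous_on \<Omega> \<phi>"
    and conc: "\<forall>x\<in>\<Omega>. ereal (\<phi> x) = cbar_transform (p_cost p) (c_transform \<Omega> (p_cost p) \<phi>) x"
    and T: "is_ot_map p \<Omega> \<phi> T"
  shows "AE x in lborel. x \<in> \<Omega> \<longrightarrow> (x, T x) \<in> c_superdifferential \<Omega> (p_cost p) \<phi>"
proof -
  have T\<Omega>: "T x \<in> \<Omega>" if "x \<in> \<Omega>" for x
    using T that measurable_space [of T "restrict_space borel \<Omega>" "restrict_space borel \<Omega>" x]
    by (simp add: is_ot_map_def space_restrict_space)
  have "AE x in lborel. x \<in> \<Omega> \<longrightarrow> (\<forall>g. GDERIV \<phi> x :> g \<longrightarrow> T x = x - inv (grad_xi p) g)"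
    using T by (simp add: is_ot_map_def)
  with AE_GDERIV_c_concave [OF p \<Omega> cont conc] show ?thesis
  proof eventually_elim
    fix x assume D: "x \<in> \<Omega> \<longrightarrow> (\<exists>g. GDERIV \<phi> x :> g)"
      and Tx: "x \<in> \<Omega> \<longrightarrow> (\<forall>g. GDERIV \<phi> x :> g \<longrightarrow> T x = x - inv (grad_xi p) g)"
    show "x \<in> \<Omega> \<longrightarrow> (x, T x) \<in> c_superdifferential \<Omega> (p_cost p) \<phi>"
    proof
      assume x: "x \<in> \<Omega>"
      then obtain g where g: "GDERIV \<phi> x :> g" using D by blast
      obtain y where y: "\<forall>z\<in>\<Omega>. \<phi> z \<le> \<phi> x + p_cost p z y - p_cost p x y"
        using c_concave_attained [OF p \<Omega> cont x] conc x by blast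
      define K where "K = norm (x - y) + 1"
      have "g = grad_xi p (x - y)"
      proof (rule GDERIV_eq_supergradient [OF g, where U = "ball x 1 \<inter> \<Omega>"])
        show "p * (p - 1) * K powr (p - 2) \<ge> 0" using p by auto
        fix z assume z: "z \<in> ball x 1 \<inter> \<Omega>"
        then have "norm (z - y) \<le> K"
          using norm_triangle_ineq [of "z - x" "x - y"] by (simp add: K_def dist_norm norm_minus_commute)
        then have "p_cost p z y \<le> p_cost p x y + grad_xi p (x - y) \<bullet> (z - x)
            + p * (p - 1) * K powr (p - 2) * (norm (z - x))\<^sup>2"
          by (intro p_cost_upper_quadratic [OF p]) (auto simp: K_def)
        with y z show "\<phi> z \<le> \<phi> x + grad_xi p (x - y) \<bullet> (z - x)
            + p * (p - 1) * K powr (p - 2) * (norm (z - x))\<^sup>2" by force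
      qed (use x \<Omega> in auto)
      moreover have "T x = x - inv (grad_xi p) g" using Tx x g by blast
      ultimately have "T x = y" by (simp add: inv_f_f [OF inj_grad_xi [OF p]])
      with y x T\<Omega> [OF x] show "(x, T x) \<in> c_superdifferential \<Omega> (p_cost p) \<phi>"
        by (simp add: c_superdifferential_iff)
    qed
  qed
qed

section \<open>Displacement near most points\<close>

text \<open>The potential itself is defined on the ball of radius \<open>R\<close> only, may be steep near its boundary, and
  its second differences leave that ball. It is replaced by the infimum \<open>f\<close> of the upper tangent
  functions given by \<open>\<Gamma>\<close>. This \<open>f\<close> is defined everywhere, agrees with \<open>\<phi>\<close> at the first components of
  \<open>\<Gamma>\<close>, where it has the same supergradients, and on the ball of radius \<open>2 R\<close> it is semiconcave and
  Lipschitz with explicit constants because all \<open>y\<close> have norm less than \<open>R\<close>.\<close>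

lemma displacement_bound_near_most_points:
  fixes \<Gamma> :: "('a::euclidean_space \<times> 'a) set" and p R \<eta> :: real
  assumes p: "p \<ge> 2" and R: "R > 0" and \<Gamma>: "\<Gamma> \<subseteq> ball 0 R \<times> ball 0 R" "\<Gamma> \<noteq> {}"
    and opt: "\<And>x y x' y'. (x, y) \<in> \<Gamma> \<Longrightarrow> (x', y') \<in> \<Gamma> \<Longrightarrow> \<phi> x' \<le> \<phi> x + p_cost p x' y - p_cost p x y"
    and \<eta>: "\<eta> > 0" "2 * DIM('a) * \<eta> \<le> R"
  obtains G :: "'a \<Rightarrow> real" where "G \<in> borel_measurable borel"
    and "\<And>x y x' y'. (x, y) \<in> \<Gamma> \<Longrightarrow> (x', y') \<in> \<Gamma> \<Longrightarrow> norm (x' - x) \<le> \<eta> \<Longrightarrow>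
           norm (y - y') powr (p - 1) \<le> G x"
    and "(\<integral>\<^sup>+x. ennreal (G x) \<partial>lborel)
      \<le> ennreal (11 * real DIM('a) ^ 4 * p * unit_ball_vol DIM('a) * (6 * R) powr (p - 1)
            * (2 * R) ^ (DIM('a) - 1) * \<eta>)"
proof -
  define d where "d = DIM('a)"
  define U where "U = (ball 0 (2 * R) :: 'a set)"
  define \<kappa> where "\<kappa> = p * (p - 1) * (3 * R) powr (p - 2)"
  define L where "L = p * (3 * R) powr (p - 1)"
  \<comment> \<open>This step makes the ball of radius \<open>2 \<eta>\<close> fit into the cross-polytope with vertices \<open>x \<plusminus> s e\<close>.\<close>
  define s where "s = 2 * real d * \<eta>"
  define q where "q z t = \<phi> (fst t) + p_cost p z (snd t) - p_cost p (fst t) (snd t)" for z t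
  define f where "f z = (INF t\<in>\<Gamma>. q z t)" for z
  have \<kappa>: "\<kappa> \<ge> 0" and L: "L \<ge> 0" using p by (auto simp: \<kappa>_def L_def)
  have d: "real d \<ge> 1" by (simp add: d_def Suc_leI)
  have s: "s > 0" "s \<le> R" using \<eta> d by (auto simp: s_def d_def)
  have inB: "x \<in> ball 0 R" "y \<in> ball 0 R" if "(x, y) \<in> \<Gamma>" for x y using \<Gamma> that by auto
  have c0: "p_cost p x y \<ge> 0" for x y :: 'a by (simp add: p_cost_def xi_def)
  have bdd: "bdd_below (q z ` \<Gamma>)" for z
  proof -
    obtain x0 y0 where t0: "(x0, y0) \<in> \<Gamma>" using \<Gamma> by auto
    have "\<phi> x0 - (2 * R) powr p \<le> q z t" if t: "t \<in> \<Gamma>" for t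
    proof -
      obtain x y where [simp]: "t = (x, y)" by (cases t)
      have "norm (x0 - y) \<le> 2 * R"
        using norm_triangle_ineq4 [of x0 y] inB [OF t0] inB [of x y] t by auto
      then have "p_cost p x0 y \<le> (2 * R) powr p"
        using p by (auto simp: p_cost_def xi_def intro!: powr_mono2)
      moreover have "\<phi> x0 \<le> \<phi> x + p_cost p x0 y - p_cost p x y" using opt [of x y x0 y0] t t0 by simp
      ultimately show ?thesis using c0 [of z y] by (simp add: q_def)
    qed
    then show ?thesis by (intro bdd_belowI2) 
  qed
  have f_le: "f z \<le> q z t" if "t \<in> \<Gamma>" for z t
    unfolding f_def using that by (intro cINF_lower bdd)
  have near: "norm (x - y) \<le> 3 * R" if "x \<in> U" "(x', y) \<in> \<Gamma>" for x x' y
    using norm_triangle_ineq4 [of x y] inB [OF that(2)] that(1) by (auto simp: U_def)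
  have quad: "q z (x', y) \<le> q x (x', y) + grad_xi p (x - y) \<bullet> (z - x) + \<kappa> * (norm (z - x))\<^sup>2"
    if "(x', y) \<in> \<Gamma>" "x \<in> U" "z \<in> U" for x y z x'
    using p_cost_upper_quadratic [OF p near near, of x x' y z x'] that by (simp add: q_def \<kappa>_def)
  have agree: "f x = \<phi> x" if xy: "(x, y) \<in> \<Gamma>" for x y
  proof (rule antisym)
    show "f x \<le> \<phi> x" using f_le [OF xy, of x] by (simp add: q_def)
    show "\<phi> x \<le> f x" unfolding f_def
      using \<Gamma> opt xy by (intro cINF_greatest) (auto simp: q_def)
  qed
  have super: "f z \<le> f x + grad_xi p (x - y) \<bullet> (z - x) + \<kappa> * (norm (z - x))\<^sup>2"
    if "(x, y) \<in> \<Gamma>" "z \<in> U" for x y z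
  proof -
    have "x \<in> U" using inB [OF that(1)] R by (auto simp: U_def)
    then show ?thesis
      using f_le [OF that(1), of z] quad [OF that(1) _ that(2), of x] agree [OF that(1)] by (simp add: q_def)
  qed
  have sc: "semiconcave_on U \<kappa> f"
    unfolding semiconcave_on_def
  proof (intro ballI allI impI)
    fix x \<epsilon> :: "_" assume x: "x \<in> U" and "(\<epsilon>::real) > 0"
    then have "(INF t\<in>\<Gamma>. q x t) < f x + \<epsilon>" by (simp add: f_def)
    then obtain t where t: "t \<in> \<Gamma>" "q x t < f x + \<epsilon>"
      using \<Gamma> bdd by (auto simp: cINF_less_iff)
    obtain x' y where [simp]: "t = (x', y)" by (cases t)
    have "f z \<le> f x + grad_xi p (x - y) \<bullet> (z - x) + \<kappa> * (norm (z - x))\<^sup>2 + \<epsilon>" if "z \<in> U" for z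
      using f_le [OF t(1), of z] quad [of x' y x z] t x that by simp
    then show "\<exists>g. \<forall>z\<in>U. f z \<le> f x + g \<bullet> (z - x) + \<kappa> * (norm (z - x))\<^sup>2 + \<epsilon>" by blast
  qed
  have lip1: "f z \<le> f x + L * norm (z - x)" if "x \<in> U" "z \<in> U" for x z
  proof -
    have "f z - L * norm (z - x) \<le> f x"
      unfolding f_def [of x]
    proof (rule cINF_greatest)
      fix t assume t: "t \<in> \<Gamma>"
      obtain x' y where [simp]: "t = (x', y)" by (cases t)
      show "f z - L * norm (z - x) \<le> q x t"
        using f_le [OF t, of z] p_cost_lipschitz [OF p near, of z x' y x] t that by (simp add: q_def L_def)
    qed (use \<Gamma> in auto)
    then show ?thesis by simp
  qed
  have lip: "\<bar>f x - f z\<bar> \<le> L * norm (x - z)" if "x \<in> U" "z \<in> U" for x z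
    using lip1 [of x z] lip1 [of z x] that by (simp add: abs_le_iff norm_minus_commute)
  have nonneg: "0 \<le> second_diff \<kappa> s f x" if x: "x \<in> ball 0 R" for x
  proof (rule second_diff_nonneg [OF sc])
    show "x \<in> U" using x R by (auto simp: U_def)
    fix e :: 'a assume "e \<in> Basis"
    then show "x + s *\<^sub>R e \<in> U \<and> x - s *\<^sub>R e \<in> U"
      using norm_triangle_ineq4 [of x "s *\<^sub>R e"] norm_triangle_ineq [of x "s *\<^sub>R e"] x s
      by (auto simp: U_def)
  qed
  define B where "B = (ball 0 R :: 'a set)"
  define S where "S x = indicator B x * second_diff \<kappa> s f x" for x
  define G where "G x = 2 powr (p - 1) / p * (S x / \<eta> + 3 * \<kappa> * \<eta> * indicator B x)" for x
  have S: "S \<in> borel_measurable borel"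
      "(\<integral>\<^sup>+x. ennreal (S x) \<partial>lborel) \<le> ennreal (s\<^sup>2 * (2 * d * unit_ball_vol d
           * (L * d * (2 * R) ^ (d - 1) + \<kappa> * R ^ d)))"
    using nn_integral_second_diff_le [OF s L, of 0 f \<kappa>] lip nonneg
    unfolding S_def [abs_def] B_def U_def d_def by blast+
  have S0: "S x \<ge> 0" for x using nonneg [of x] by (auto simp: S_def B_def indicator_def)
  have Bm [measurable]: "B \<in> sets borel" by (simp add: B_def)
  note S(1) [measurable]
  have Gm: "G \<in> borel_measurable borel" unfolding G_def [abs_def] by measurable
  moreover have "norm (y - y') powr (p - 1) \<le> G x"
    if xy: "(x, y) \<in> \<Gamma>" and xy': "(x', y') \<in> \<Gamma>" and close: "norm (x' - x) \<le> \<eta>" for x y x' y'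
  proof -
    have xB: "x \<in> B" "x' \<in> B" using inB [OF xy] inB [OF xy'] by (auto simp: B_def)
    then have xU: "x \<in> U" "x' \<in> U" using R by (auto simp: U_def B_def)
    have "norm (grad_xi p (x - y) - grad_xi p (x' - y')) \<le> second_diff \<kappa> s f x / \<eta> + 2 * \<kappa> * \<eta>"
      unfolding s_def d_def
      by (rule supergradients_close [where r = R and a = 0 and x' = x'])
        (use sc \<kappa> \<eta> xB close super [OF xy] super [OF xy'] in \<open>auto simp: U_def B_def d_def\<close>)
    \<comment> \<open>Strong monotonicity compares gradients with a common first point, hence the move from \<open>x'\<close> to \<open>x\<close>.\<close>
    moreover have "norm (grad_xi p (x' - y') - grad_xi p (x - y')) \<le> \<kappa> * norm ((x' - y') - (x - y'))"
      unfolding \<kappa>_def by (rule grad_xi_lipschitz [OF p near near]) (use xU xy' in auto)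
    then have "norm (grad_xi p (x' - y') - grad_xi p (x - y')) \<le> \<kappa> * \<eta>"
      using close \<kappa> mult_left_mono [OF close \<kappa>] by simp
    ultimately have "norm (grad_xi p (x - y) - grad_xi p (x - y'))
        \<le> second_diff \<kappa> s f x / \<eta> + 3 * \<kappa> * \<eta>"
      using norm_triangle_ineq [of "grad_xi p (x - y) - grad_xi p (x' - y')"
          "grad_xi p (x' - y') - grad_xi p (x - y')"] by simp
    moreover have "p / 2 powr (p - 1) * norm ((x - y) - (x - y')) powr (p - 1)
        \<le> norm (grad_xi p (x - y) - grad_xi p (x - y'))"
      by (rule grad_xi_strongly_monotone [OF p])
    ultimately have "p / 2 powr (p - 1) * norm (y - y') powr (p - 1) \<le> S x / \<eta> + 3 * \<kappa> * \<eta>"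
      using xB by (simp add: S_def norm_minus_commute)
    then have "2 powr (p - 1) / p * (p / 2 powr (p - 1) * norm (y - y') powr (p - 1))
        \<le> 2 powr (p - 1) / p * (S x / \<eta> + 3 * \<kappa> * \<eta>)"
      using p by (intro mult_left_mono) auto
    then show ?thesis using p xB by (simp add: G_def)
  qed
  moreover have "(\<integral>\<^sup>+x. ennreal (G x) \<partial>lborel)
      \<le> ennreal (11 * real d ^ 4 * p * unit_ball_vol d * (6 * R) powr (p - 1) * (2 * R) ^ (d - 1) * \<eta>)"
  proof -
    define b where "b = unit_ball_vol (real d)"
    define P where "P = (3 * R) powr (p - 1) * (2 * R) ^ (d - 1)"
    have b: "b \<ge> 0" by (simp add: b_def)
    have P: "P \<ge> 0" using R by (simp add: P_def)
    have \<kappa>R: "\<kappa> * R ^ d \<le> p * (p - 1) * P"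
    proof -
      have "(3 * R) powr (p - 1) = (3 * R) powr (p - 2) * (3 * R)"
        using R powr_add [of "3 * R" "p - 2" 1] by simp
      moreover have "R ^ d \<le> 3 * R * (2 * R) ^ (d - 1)"
      proof -
        have "R ^ d = R * R ^ (d - 1)" using d by (cases d) auto
        also have "\<dots> \<le> (3 * R) * (2 * R) ^ (d - 1)" using R by (intro mult_mono power_mono) auto
        finally show ?thesis .
      qed
      ultimately show ?thesis
        using mult_left_mono [of "R ^ d" "3 * R * (2 * R) ^ (d - 1)" \<kappa>] \<kappa> by (simp add: \<kappa>_def P_def mult_ac)
    qed
    have "(\<integral>\<^sup>+x. ennreal (G x) \<partial>lborel) = (\<integral>\<^sup>+x. ennreal (2 powr (p - 1) / p / \<eta>) * ennreal (S x)
        + ennreal (2 powr (p - 1) / p * (3 * \<kappa> * \<eta>)) * indicator B x \<partial>lborel)"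
    proof (intro nn_integral_cong)
      fix x
      have "ennreal (G x) = ennreal (2 powr (p - 1) / p / \<eta> * S x
          + 2 powr (p - 1) / p * (3 * \<kappa> * \<eta>) * indicator B x)"
        by (simp add: G_def algebra_simps)
      also have "\<dots> = ennreal (2 powr (p - 1) / p / \<eta> * S x) + ennreal (2 powr (p - 1) / p * (3 * \<kappa> * \<eta>) * indicator B x)"
        using p \<eta> S0 [of x] \<kappa> by (intro ennreal_plus) auto
      also have "ennreal (2 powr (p - 1) / p / \<eta> * S x) = ennreal (2 powr (p - 1) / p / \<eta>) * ennreal (S x)"
        using p \<eta> by (intro ennreal_mult') auto
      also have "ennreal (2 powr (p - 1) / p * (3 * \<kappa> * \<eta>) * indicator B x)
          = ennreal (2 powr (p - 1) / p * (3 * \<kappa> * \<eta>)) * indicator B x"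
        by (auto simp: indicator_def)
      finally show "ennreal (G x) = ennreal (2 powr (p - 1) / p / \<eta>) * ennreal (S x)
        + ennreal (2 powr (p - 1) / p * (3 * \<kappa> * \<eta>)) * indicator B x" .
    qed
    also have "\<dots> = ennreal (2 powr (p - 1) / p / \<eta>) * (\<integral>\<^sup>+x. ennreal (S x) \<partial>lborel)
        + ennreal (2 powr (p - 1) / p * (3 * \<kappa> * \<eta>)) * emeasure lborel B"
      by (subst nn_integral_add) (auto simp: nn_integral_cmult)
    also have "\<dots> \<le> ennreal (2 powr (p - 1) / p / \<eta>) * ennreal (s\<^sup>2 * (2 * d * b * (L * d * (2 * R) ^ (d - 1) + \<kappa> * R ^ d)))
        + ennreal (2 powr (p - 1) / p * (3 * \<kappa> * \<eta>)) * ennreal (b * R ^ d)"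
      using S(2) R by (intro add_mono mult_left_mono) (auto simp: b_def B_def emeasure_ball d_def)
    also have "\<dots> = ennreal (2 powr (p - 1) / p / \<eta> * (s\<^sup>2 * (2 * d * b * (L * d * (2 * R) ^ (d - 1) + \<kappa> * R ^ d)))
        + 2 powr (p - 1) / p * (3 * \<kappa> * \<eta>) * (b * R ^ d))"
    proof -
      have "ennreal u * ennreal v + ennreal w * ennreal y = ennreal (u * v + w * y)"
        if "0 \<le> u" "0 \<le> v" "0 \<le> w" "0 \<le> y" for u v w y
        using that by (simp add: ennreal_plus ennreal_mult)
      then show ?thesis using p \<eta> \<kappa> L R b by auto
    qed
    also have "\<dots> \<le> ennreal (11 * real d ^ 4 * p * b * (2 powr (p - 1) * P) * \<eta>)"
    proof (rule ennreal_leI)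
      have "L * d * (2 * R) ^ (d - 1) + \<kappa> * R ^ d \<le> p * d * P + p * (p - 1) * P"
        using \<kappa>R by (simp add: L_def P_def mult_ac)
      also have "\<dots> \<le> p * d * P + p * (p - 1) * P * d"
        using d p P mult_left_mono [of 1 "real d" "p * (p - 1) * P"] by simp
      also have "\<dots> = p\<^sup>2 * d * P" by (simp add: power2_eq_square algebra_simps)
      finally have 1: "L * d * (2 * R) ^ (d - 1) + \<kappa> * R ^ d \<le> p\<^sup>2 * d * P" .
      have 2: "s\<^sup>2 * (2 * d * b * (L * d * (2 * R) ^ (d - 1) + \<kappa> * R ^ d)) \<le> s\<^sup>2 * (2 * d * b * (p\<^sup>2 * d * P))"
        using 1 b by (intro mult_left_mono) auto
      have "2 powr (p - 1) / p / \<eta> * (s\<^sup>2 * (2 * d * b * (L * d * (2 * R) ^ (d - 1) + \<kappa> * R ^ d)))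
          \<le> 2 powr (p - 1) / p / \<eta> * (s\<^sup>2 * (2 * d * b * (p\<^sup>2 * d * P)))"
        using p \<eta> by (intro mult_left_mono [OF 2]) auto
      also have "\<dots> = 8 * real d ^ 4 * p * b * (2 powr (p - 1) * P) * \<eta>"
        using p \<eta> by (simp add: s_def power2_eq_square power4_eq_xxxx field_simps)
      finally have 2: "2 powr (p - 1) / p / \<eta> * (s\<^sup>2 * (2 * d * b * (L * d * (2 * R) ^ (d - 1) + \<kappa> * R ^ d)))
          \<le> 8 * real d ^ 4 * p * b * (2 powr (p - 1) * P) * \<eta>" .
      have "2 powr (p - 1) / p * (3 * \<kappa> * \<eta>) * (b * R ^ d) = 2 powr (p - 1) / p * (3 * \<eta> * b) * (\<kappa> * R ^ d)"
        by (simp add: mult_ac)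
      also have "\<dots> \<le> 2 powr (p - 1) / p * (3 * \<eta> * b) * (p * p * P)"
      proof -
        have "p * (p - 1) * P \<le> p * p * P" using p P by (intro mult_right_mono mult_left_mono) auto
        with \<kappa>R have "\<kappa> * R ^ d \<le> p * p * P" by (rule order_trans)
        then show ?thesis using p \<eta> b by (intro mult_left_mono) auto
      qed
      also have "\<dots> = 3 * p * b * (2 powr (p - 1) * P) * \<eta> * 1" using p by (simp add: field_simps)
      also have "\<dots> \<le> 3 * p * b * (2 powr (p - 1) * P) * \<eta> * real d ^ 4"
        using p b P \<eta> d by (intro mult_left_mono) auto
      finally show "2 powr (p - 1) / p / \<eta> * (s\<^sup>2 * (2 * d * b * (L * d * (2 * R) ^ (d - 1) + \<kappa> * R ^ d)))
        + 2 powr (p - 1) / p * (3 * \<kappa> * \<eta>) * (b * R ^ d)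
        \<le> 11 * real d ^ 4 * p * b * (2 powr (p - 1) * P) * \<eta>"
        using 2 by (simp add: mult_ac)
    qed
    also have "2 powr (p - 1) * P = (6 * R) powr (p - 1) * (2 * R) ^ (d - 1)"
    proof -
      have "(6 * R) powr (p - 1) = (2 * (3 * R)) powr (p - 1)" by simp
      also have "\<dots> = 2 powr (p - 1) * (3 * R) powr (p - 1)" using R by (subst powr_mult) auto
      finally show ?thesis by (simp add: P_def)
    qed
    finally show ?thesis by (simp add: b_def mult_ac)
  qed
  ultimately show thesis unfolding d_def using that by blast
qed

section \<open>Approximate gluing of couplings\<close>

text \<open>The inner integral is \<open>1\<close> whenever the value \<open>f x\<close> has positive probability, which is the case for
  almost every \<open>x\<close>.\<close>

lemma prob_kernel_marginal:
  fixes f :: "'a \<Rightarrow> nat" and g :: "'b \<Rightarrow> nat"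
  assumes P: "prob_space P" and Q: "prob_space Q"
    and f: "f \<in> P \<rightarrow>\<^sub>M count_space UNIV" and g: "g \<in> Q \<rightarrow>\<^sub>M count_space UNIV"
    and law: "\<And>n. emeasure P {x \<in> space P. f x = n} = emeasure Q {y \<in> space Q. g y = n}"
    and A: "A \<in> sets P"
  shows "(\<integral>\<^sup>+x. \<integral>\<^sup>+y. (if f x = g y then ennreal (1 / measure Q {y \<in> space Q. g y = f x}) else 0)
            * indicator A x \<partial>Q \<partial>P) = emeasure P A"
proof -
  interpret P: prob_space P by (rule P)
  interpret Q: prob_space Q by (rule Q)
  note f [measurable] g [measurable] A [measurable]
  define m where "m n = measure Q {y \<in> space Q. g y = n}" for n
  have inner: "(\<integral>\<^sup>+y. (if f x = g y then ennreal (1 / m (f x)) else 0) * indicator A x \<partial>Q)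
      = indicator A x" if pos: "m (f x) \<noteq> 0" for x
  proof -
    have "(\<integral>\<^sup>+y. (if f x = g y then ennreal (1 / m (f x)) else 0) * indicator A x \<partial>Q)
        = (\<integral>\<^sup>+y. ennreal (1 / m (f x)) * indicator A x * indicator {y \<in> space Q. g y = f x} y \<partial>Q)"
      by (intro nn_integral_cong) (auto simp: indicator_def)
    also have "\<dots> = ennreal (1 / m (f x)) * indicator A x * ennreal (m (f x))"
      by (subst nn_integral_cmult_indicator) (auto simp: m_def Q.emeasure_eq_measure)
    also have "\<dots> = indicator A x * ennreal (1 / m (f x) * m (f x))"
      by (subst ennreal_mult) (auto simp: m_def mult_ac)
    finally show ?thesis using pos by simp
  qed
  have "AE x in P. \<forall>n. m n = 0 \<longrightarrow> f x \<noteq> n"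
  proof (unfold AE_all_countable, intro allI)
    fix n
    show "AE x in P. m n = 0 \<longrightarrow> f x \<noteq> n"
    proof (cases "m n = 0")
      case True
      then have "emeasure P {x \<in> space P. f x = n} = 0"
        by (simp add: law m_def Q.emeasure_eq_measure)
      then have "AE x in P. \<not> f x = n" by (subst AE_iff_measurable [OF _ refl]) auto
      then show ?thesis by simp
    qed simp
  qed
  then have "AE x in P. (\<integral>\<^sup>+y. (if f x = g y then ennreal (1 / m (f x)) else 0) * indicator A x \<partial>Q)
      = indicator A x"
    by eventually_elim (rule inner, blast)
  then have "(\<integral>\<^sup>+x. \<integral>\<^sup>+y. (if f x = g y then ennreal (1 / m (f x)) else 0) * indicator A x \<partial>Q \<partial>P)
      = (\<integral>\<^sup>+x. indicator A x \<partial>P)"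
    by (rule nn_integral_cong_AE)
  then show ?thesis unfolding m_def by simp
qed

text \<open>The coupling that makes the two variables conditionally independent given the common value of the
  observable. It has an explicit density with respect to the product because the observable is
  discrete, so no disintegration of measures is required.\<close>

lemma coupling_matching_observable:
  fixes f :: "'a \<Rightarrow> nat" and g :: "'b \<Rightarrow> nat"
  assumes P: "prob_space P" and Q: "prob_space Q"
    and f: "f \<in> P \<rightarrow>\<^sub>M count_space UNIV" and g: "g \<in> Q \<rightarrow>\<^sub>M count_space UNIV"
    and law: "\<And>n. emeasure P {x \<in> space P. f x = n} = emeasure Q {y \<in> space Q. g y = n}"
  obtains \<pi> where "\<pi> \<in> couplings P Q" "AE z in \<pi>. f (fst z) = g (snd z)"
proof -
  interpret P: prob_space P by (rule P)
  interpret Q: prob_space Q by (rule Q)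
  interpret PQ: pair_sigma_finite P Q ..
  note f [measurable] g [measurable]
  have law': "measure P {x \<in> space P. f x = n} = measure Q {y \<in> space Q. g y = n}" for n
    using law [of n] by (simp add: measure_def)
  define k where "k z = (if f (fst z) = g (snd z)
      then ennreal (1 / measure Q {y \<in> space Q. g y = f (fst z)}) else 0)" for z
  have k [measurable]: "k \<in> borel_measurable (P \<Otimes>\<^sub>M Q)"
  proof -
    have "(\<lambda>z. ennreal (1 / measure Q {y \<in> space Q. g y = f (fst z)})) \<in> borel_measurable (P \<Otimes>\<^sub>M Q)"
      by (rule measurable_compose [where f = "\<lambda>z. f (fst z)" and N = "count_space UNIV"]) auto
    moreover have "{z \<in> space (P \<Otimes>\<^sub>M Q). f (fst z) = g (snd z)}
        = (\<Union>n. {z \<in> space (P \<Otimes>\<^sub>M Q). f (fst z) = n \<and> g (snd z) = n})" by auto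
    then have "{z \<in> space (P \<Otimes>\<^sub>M Q). f (fst z) = g (snd z)} \<in> sets (P \<Otimes>\<^sub>M Q)" by simp
    ultimately show ?thesis unfolding k_def [abs_def] by (intro measurable_If) auto
  qed
  define \<pi> where "\<pi> = density (P \<Otimes>\<^sub>M Q) k"
  have fst: "distr \<pi> P fst = P"
  proof (rule measure_eqI)
    fix A assume "A \<in> sets (distr \<pi> P fst)"
    then have A [measurable]: "A \<in> sets P" by simp
    have "emeasure (distr \<pi> P fst) A = (\<integral>\<^sup>+z. k z * indicator A (fst z) \<partial>(P \<Otimes>\<^sub>M Q))"
      unfolding \<pi>_def
      by (subst emeasure_distr, simp_all add: emeasure_density)
        (auto intro!: nn_integral_cong simp: indicator_def)
    also have "\<dots> = (\<integral>\<^sup>+x. \<integral>\<^sup>+y. k (x, y) * indicator A x \<partial>Q \<partial>P)"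
      by (subst Q.nn_integral_fst [symmetric]) auto
    also have "\<dots> = emeasure P A"
      unfolding k_def fst_conv snd_conv by (rule prob_kernel_marginal [OF P Q f g law A])
    finally show "emeasure (distr \<pi> P fst) A = emeasure P A" .
  qed simp
  have snd: "distr \<pi> Q snd = Q"
  proof (rule measure_eqI)
    fix A assume "A \<in> sets (distr \<pi> Q snd)"
    then have A [measurable]: "A \<in> sets Q" by simp
    have "emeasure (distr \<pi> Q snd) A = (\<integral>\<^sup>+z. k z * indicator A (snd z) \<partial>(P \<Otimes>\<^sub>M Q))"
      unfolding \<pi>_def
      by (subst emeasure_distr, simp_all add: emeasure_density)
        (auto intro!: nn_integral_cong simp: indicator_def)
    also have "\<dots> = (\<integral>\<^sup>+y. \<integral>\<^sup>+x. k (x, y) * indicator A y \<partial>P \<partial>Q)"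
      by (subst PQ.nn_integral_snd [symmetric]) auto
    also have "\<dots> = (\<integral>\<^sup>+y. \<integral>\<^sup>+x. (if g y = f x then ennreal (1 / measure P {x \<in> space P. f x = g y}) else 0)
            * indicator A y \<partial>P \<partial>Q)"
      by (intro nn_integral_cong) (auto simp: k_def law')
    also have "\<dots> = emeasure Q A"
      using prob_kernel_marginal [OF Q P g f law [symmetric] A] by simp
    finally show "emeasure (distr \<pi> Q snd) A = emeasure Q A" .
  qed simp
  have "AE z in \<pi>. f (fst z) = g (snd z)"
    unfolding \<pi>_def by (subst AE_density) (auto simp: k_def)
  moreover have "\<pi> \<in> couplings P Q"
    using fst snd by (simp add: couplings_def \<pi>_def)
  ultimately show thesis using that by blast
qed

text \<open>The cell of a point is the index of the first element of a dense sequence within distance \<open>h / 2\<close>.\<close>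

lemma small_cells:
  fixes h :: real
  assumes "h > 0"
  obtains \<kappa> :: "'a::{metric_space,second_countable_topology} \<Rightarrow> nat"
  where "\<kappa> \<in> borel \<rightarrow>\<^sub>M count_space UNIV" "\<And>x y. \<kappa> x = \<kappa> y \<Longrightarrow> dist x y \<le> h"
proof -
  obtain D :: "'a set" where D: "countable D" "\<And>X. open X \<Longrightarrow> X \<noteq> {} \<Longrightarrow> \<exists>d\<in>D. d \<in> X"
    using countable_dense_exists by metis
  define \<kappa> where "\<kappa> x = (LEAST n. dist x (from_nat_into D n) < h / 2)" for x
  have *: "dist x (from_nat_into D (\<kappa> x)) < h / 2" for x
  proof -
    obtain d where "d \<in> D" "d \<in> ball x (h / 2)" using D(2) [of "ball x (h / 2)"] assms by auto
    then have "\<exists>n. dist x (from_nat_into D n) < h / 2"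
      using from_nat_into_surj [OF D(1)] by (metis mem_ball)
    then show ?thesis unfolding \<kappa>_def by (rule LeastI_ex)
  qed
  show thesis
  proof
    show "\<kappa> \<in> borel \<rightarrow>\<^sub>M count_space UNIV" unfolding \<kappa>_def [abs_def] by measurable
    show "dist x y \<le> h" if "\<kappa> x = \<kappa> y" for x y
      using *[of x] *[of y] dist_triangle2 [of x y "from_nat_into D (\<kappa> x)"] that by simp
  qed
qed

lemma AE_in_spt:
  fixes \<mu> :: "'a::second_countable_topology measure"
  assumes "\<mu> \<in> borel_probs X"
  shows "AE x in \<mu>. x \<in> spt \<mu>"
proof -
  have sets: "sets \<mu> = sets (restrict_space borel X)" using assms by (simp add: borel_probs_def)
  then have sp: "space \<mu> = X" by (metis sets_eq_imp_space_eq space_restrict_space space_borel Int_UNIV_right)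
  have open_sets: "U \<inter> space \<mu> \<in> sets \<mu>" if "open U" for U
    using that unfolding sets sp by (auto simp: sets_restrict_space)
  obtain B :: "'a set set" where B: "countable B" "topological_basis B" using ex_countable_basis by blast
  have "AE x in \<mu>. \<forall>U\<in>{U\<in>B. emeasure \<mu> (U \<inter> space \<mu>) = 0}. x \<notin> U"
  proof (subst AE_ball_countable)
    show "\<forall>U\<in>{U\<in>B. emeasure \<mu> (U \<inter> space \<mu>) = 0}. AE x in \<mu>. x \<notin> U"
    proof
      fix U assume "U \<in> {U\<in>B. emeasure \<mu> (U \<inter> space \<mu>) = 0}"
      then show "AE x in \<mu>. x \<notin> U"
        using open_sets topological_basis_open [OF B(2)]
        by (intro AE_I [where N = "U \<inter> space \<mu>"]) auto
    qed
  qed (use B in simp)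
  with AE_space show ?thesis
  proof eventually_elim
    fix x assume x: "x \<in> space \<mu>" and notin: "\<forall>U\<in>{U\<in>B. emeasure \<mu> (U \<inter> space \<mu>) = 0}. x \<notin> U"
    have "emeasure \<mu> (U \<inter> space \<mu>) > 0" if U: "open U" "x \<in> U" for U
    proof -
      obtain V where V: "V \<in> B" "x \<in> V" "V \<subseteq> U" using topological_basisE [OF B(2) U] by blast
      have "0 < emeasure \<mu> (V \<inter> space \<mu>)" using notin V by (auto simp: zero_less_iff_neq_zero)
      also have "\<dots> \<le> emeasure \<mu> (U \<inter> space \<mu>)" using V open_sets [OF U(1)] by (intro emeasure_mono) auto
      finally show ?thesis .
    qed
    with x show "x \<in> spt \<mu>" by (auto simp: spt_def)
  qed
qed

text \<open>The coupling \<open>\<gamma>\<close> provides pairs \<open>(x, x')\<close>, the plan \<open>\<gamma>'\<close> pairs \<open>(x'', y)\<close>; match them so that \<open>x'\<close> and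
  \<open>x''\<close> lie in the same cell. If \<open>x\<close> and \<open>x'\<close> are within \<open>h\<close>, then \<open>x\<close> and \<open>x''\<close> are within \<open>2 h\<close> and the
  bound \<open>H\<close> applies; otherwise the crude bound \<open>D\<close> is used.\<close>

lemma glued_coupling_cost_le:
  fixes \<Omega> :: "'a::euclidean_space set" and T :: "'a \<Rightarrow> 'a" and H :: "'a \<Rightarrow> ennreal"
  assumes \<rho>: "\<rho> \<in> borel_probs \<Omega>" and \<rho>': "\<rho>' \<in> borel_probs \<Omega>"
    and \<gamma>': "\<gamma>' \<in> borel_probs (\<Omega> \<times> \<Omega>)" "distr \<gamma>' (restrict_space borel \<Omega>) fst = \<rho>'"
    and T: "T \<in> restrict_space borel \<Omega> \<rightarrow>\<^sub>M restrict_space borel \<Omega>"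
    and \<gamma>: "\<gamma> \<in> couplings \<rho> \<rho>'" and h: "h > 0"
    and E: "AE x in \<rho>. x \<in> E" and \<Gamma>: "AE z in \<gamma>'. z \<in> \<Gamma>"
    and H: "H \<in> borel_measurable borel"
    and near: "\<And>x x' y. x \<in> E \<Longrightarrow> (x', y) \<in> \<Gamma> \<Longrightarrow> norm (x' - x) \<le> 2 * h \<Longrightarrow>
                 ennreal (norm (T x - y) powr q) \<le> H x"
    and far: "\<And>x x' y. x \<in> E \<Longrightarrow> (x', y) \<in> \<Gamma> \<Longrightarrow> norm (T x - y) powr q \<le> D"
  shows "(INF \<pi>\<in>couplings (distr \<rho> (restrict_space borel \<Omega>) T) (distr \<gamma>' (restrict_space borel \<Omega>) snd).
            \<integral>\<^sup>+(x, y). ennreal (norm (x - y) powr q) \<partial>\<pi>)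
      \<le> (\<integral>\<^sup>+x. H x \<partial>\<rho>) + ennreal D * emeasure \<gamma> {z \<in> space \<gamma>. h < norm (fst z - snd z)}"
proof -
  define B where "B = (restrict_space borel \<Omega> :: 'a measure)"
  define N1 N2 where "N1 = distr \<rho> B T" and "N2 = distr \<gamma>' B snd"
  have sets_\<rho> [measurable_cong]: "sets \<rho> = sets B" "sets \<rho>' = sets B"
    using \<rho> \<rho>' by (auto simp: borel_probs_def B_def)
  have sets_\<gamma> [measurable_cong]: "sets \<gamma> = sets (B \<Otimes>\<^sub>M B)"
    using \<gamma> sets_\<rho> by (auto simp: couplings_def cong: sets_pair_measure_cong)
  have marg: "distr \<gamma> \<rho> fst = \<rho>" "distr \<gamma> \<rho>' snd = \<rho>'" using \<gamma> by (auto simp: couplings_def)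
  have idB [measurable]: "(\<lambda>x. x) \<in> B \<rightarrow>\<^sub>M borel" unfolding B_def by (rule measurable_restrict_space1) simp
  have sets_\<gamma>': "sets \<gamma>' = sets (restrict_space borel (\<Omega> \<times> \<Omega>))" using \<gamma>' by (simp add: borel_probs_def)
  have \<gamma>'_proj [measurable]: "fst \<in> \<gamma>' \<rightarrow>\<^sub>M B" "snd \<in> \<gamma>' \<rightarrow>\<^sub>M B"
    unfolding measurable_cong_sets [OF sets_\<gamma>' refl] B_def
    by (auto intro!: measurable_restrict_space3 simp: borel_prod [symmetric])
  have T [measurable]: "T \<in> B \<rightarrow>\<^sub>M B" using T by (simp add: B_def)
  note H [measurable]
  have "prob_space \<rho>" "prob_space \<gamma>'" using \<rho> \<gamma>' by (auto simp: borel_probs_def)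
  then have prob: "prob_space \<gamma>" "prob_space \<gamma>'"
    using prob_space_distrD [of fst \<gamma> \<rho>] marg by auto
  obtain \<kappa> :: "'a \<Rightarrow> nat" where \<kappa> [measurable]: "\<kappa> \<in> borel \<rightarrow>\<^sub>M count_space UNIV"
      and cell: "\<And>x y. \<kappa> x = \<kappa> y \<Longrightarrow> dist x y \<le> h"
    using small_cells [OF h] by blast
  have \<kappa>B [measurable]: "\<kappa> \<in> B \<rightarrow>\<^sub>M count_space UNIV" using measurable_compose [OF idB \<kappa>] .
  have law: "emeasure \<gamma> {z \<in> space \<gamma>. \<kappa> (snd z) = n} = emeasure \<gamma>' {z \<in> space \<gamma>'. \<kappa> (fst z) = n}" for n
  proof -
    have S: "{x \<in> space \<rho>'. \<kappa> x = n} \<in> sets \<rho>'" by measurable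
    have "emeasure \<gamma> {z \<in> space \<gamma>. \<kappa> (snd z) = n} = emeasure (distr \<gamma> \<rho>' snd) {x \<in> space \<rho>'. \<kappa> x = n}"
      using S measurable_space [of snd \<gamma> \<rho>'] by (subst emeasure_distr) (auto intro!: arg_cong [where f = "emeasure \<gamma>"])
    also have "\<dots> = emeasure (distr \<gamma>' B fst) {x \<in> space \<rho>'. \<kappa> x = n}"
      using marg \<gamma>' by (simp add: B_def)
    also have "\<dots> = emeasure \<gamma>' {z \<in> space \<gamma>'. \<kappa> (fst z) = n}"
      using S measurable_space [OF \<gamma>'_proj(1)] sets_eq_imp_space_eq [OF sets_\<rho>(2)]
      by (subst emeasure_distr) (auto intro!: arg_cong [where f = "emeasure \<gamma>'"] simp: sets_\<rho>)
    finally show ?thesis .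
  qed
  obtain \<pi>0 where \<pi>0: "\<pi>0 \<in> couplings \<gamma> \<gamma>'" "AE w in \<pi>0. \<kappa> (snd (fst w)) = \<kappa> (fst (snd w))"
    by (rule coupling_matching_observable [OF prob, of "\<lambda>z. \<kappa> (snd z)" "\<lambda>z. \<kappa> (fst z)"])
      (use law in measurable)
  have sets_\<pi>0 [measurable_cong]: "sets \<pi>0 = sets (\<gamma> \<Otimes>\<^sub>M \<gamma>')"
    and m0: "distr \<pi>0 \<gamma> fst = \<gamma>" "distr \<pi>0 \<gamma>' snd = \<gamma>'"
    using \<pi>0 by (auto simp: couplings_def)
  define F where "F w = (T (fst (fst w)), snd (snd w))" for w :: "('a \<times> 'a) \<times> 'a \<times> 'a"
  have sets_N [measurable_cong]: "sets N1 = sets B" "sets N2 = sets B" by (auto simp: N1_def N2_def)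
  have proj0 [measurable]: "(\<lambda>w. fst (fst w)) \<in> \<pi>0 \<rightarrow>\<^sub>M B" "(\<lambda>w. snd (snd w)) \<in> \<pi>0 \<rightarrow>\<^sub>M B"
    by (rule measurable_compose [of fst _ \<gamma>], simp_all)
  have F [measurable]: "F \<in> \<pi>0 \<rightarrow>\<^sub>M N1 \<Otimes>\<^sub>M N2"
    unfolding F_def measurable_cong_sets [OF refl sets_pair_measure_cong [OF sets_N]]
    by (intro measurable_Pair measurable_compose [OF proj0(1) T] proj0)
  define \<pi> where "\<pi> = distr \<pi>0 (N1 \<Otimes>\<^sub>M N2) F"
  have "\<pi> \<in> couplings N1 N2"
  proof -
    have "distr \<pi> N1 fst = distr \<pi>0 N1 (\<lambda>w. T (fst (fst w)))"
      unfolding \<pi>_def by (subst distr_distr) (auto simp: F_def o_def)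
    also have "\<dots> = distr (distr (distr \<pi>0 \<gamma> fst) \<rho> fst) N1 T"
      by (subst distr_distr, measurable, subst distr_distr, measurable) (simp add: o_def)
    also have "\<dots> = N1" unfolding m0 marg by (simp add: N1_def cong: distr_cong)
    finally have 1: "distr \<pi> N1 fst = N1" .
    have sndN: "snd \<in> \<gamma>' \<rightarrow>\<^sub>M N2"
      unfolding measurable_cong_sets [OF refl sets_N(2)] by (rule \<gamma>'_proj)
    have "distr \<pi> N2 snd = distr \<pi>0 N2 (\<lambda>w. snd (snd w))"
      unfolding \<pi>_def by (subst distr_distr) (auto simp: F_def o_def)
    also have "\<dots> = distr (distr \<pi>0 \<gamma>' snd) N2 snd"
      by (subst distr_distr [OF sndN], measurable) (simp add: o_def)
    also have "\<dots> = N2" unfolding m0 by (simp add: N2_def cong: distr_cong)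
    finally show ?thesis using 1 by (simp add: couplings_def \<pi>_def)
  qed
  then have "(INF \<pi>\<in>couplings N1 N2. \<integral>\<^sup>+(x, y). ennreal (norm (x - y) powr q) \<partial>\<pi>)
      \<le> (\<integral>\<^sup>+(x, y). ennreal (norm (x - y) powr q) \<partial>\<pi>)"
    by (rule INF_lower)
  also have "\<dots> = (\<integral>\<^sup>+w. ennreal (norm (T (fst (fst w)) - snd (snd w)) powr q) \<partial>\<pi>0)"
    unfolding \<pi>_def by (subst nn_integral_distr) (auto simp: F_def)
  also have "\<dots> \<le> (\<integral>\<^sup>+w. H (fst (fst w)) + ennreal D * indicator {z \<in> space \<gamma>. h < norm (fst z - snd z)} (fst w) \<partial>\<pi>0)"
  proof (rule nn_integral_mono_AE)
    have "AE x in distr \<gamma> \<rho> fst. x \<in> E" unfolding marg by (rule E)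
    then have "AE z in \<gamma>. fst z \<in> E" by (rule AE_distrD [rotated]) measurable
    then have "AE z in distr \<pi>0 \<gamma> fst. fst z \<in> E" unfolding m0 .
    then have "AE w in \<pi>0. fst (fst w) \<in> E" by (rule AE_distrD [rotated]) measurable
    moreover have "AE z in distr \<pi>0 \<gamma>' snd. z \<in> \<Gamma>" unfolding m0 by (rule \<Gamma>)
    then have "AE w in \<pi>0. snd w \<in> \<Gamma>" by (rule AE_distrD [rotated]) measurable
    ultimately show "AE w in \<pi>0. ennreal (norm (T (fst (fst w)) - snd (snd w)) powr q)
        \<le> H (fst (fst w)) + ennreal D * indicator {z \<in> space \<gamma>. h < norm (fst z - snd z)} (fst w)"
      using \<pi>0(2) AE_space
    proof eventually_elim
      fix w assume w: "fst (fst w) \<in> E" "snd w \<in> \<Gamma>" "\<kappa> (snd (fst w)) = \<kappa> (fst (snd w))" "w \<in> space \<pi>0"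
      obtain x x' x'' y where [simp]: "w = ((x, x'), (x'', y))" by (metis prod.exhaust)
      have sp: "(x, x') \<in> space \<gamma>"
        using w(4) sets_eq_imp_space_eq [OF sets_\<pi>0] by (simp add: space_pair_measure)
      have "dist x' x'' \<le> h" using cell w(3) by simp
      show "ennreal (norm (T (fst (fst w)) - snd (snd w)) powr q)
        \<le> H (fst (fst w)) + ennreal D * indicator {z \<in> space \<gamma>. h < norm (fst z - snd z)} (fst w)"
      proof (cases "norm (x - x') \<le> h")
        case True
        then have "norm (x'' - x) \<le> 2 * h"
          using \<open>dist x' x'' \<le> h\<close> norm_triangle_ineq4 [of "x'' - x'" "x - x'"] by (simp add: dist_norm norm_minus_commute)
        then show ?thesis using near [of x x'' y] w True by simp
      next
        case False
        have "ennreal (norm (T x - y) powr q) \<le> ennreal D"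
          using far [of x x'' y] w by (intro ennreal_leI) simp
        also have "\<dots> \<le> H x + ennreal D" by simp
        finally show ?thesis using False sp by simp
      qed
    qed
  qed
  also have "\<dots> = (\<integral>\<^sup>+w. H (fst (fst w)) \<partial>\<pi>0)
      + (\<integral>\<^sup>+w. ennreal D * indicator {z \<in> space \<gamma>. h < norm (fst z - snd z)} (fst w) \<partial>\<pi>0)"
    by (rule nn_integral_add) measurable
  also have "(\<integral>\<^sup>+w. H (fst (fst w)) \<partial>\<pi>0) = (\<integral>\<^sup>+x. H x \<partial>\<rho>)"
  proof -
    have "(\<integral>\<^sup>+x. H x \<partial>\<rho>) = (\<integral>\<^sup>+x. H x \<partial>distr (distr \<pi>0 \<gamma> fst) \<rho> fst)" by (simp add: m0 marg)
    also have "\<dots> = (\<integral>\<^sup>+w. H (fst (fst w)) \<partial>\<pi>0)"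
      by (subst nn_integral_distr, measurable, subst nn_integral_distr, measurable)
    finally show ?thesis ..
  qed
  also have "(\<integral>\<^sup>+w. ennreal D * indicator {z \<in> space \<gamma>. h < norm (fst z - snd z)} (fst w) \<partial>\<pi>0)
      = ennreal D * emeasure \<gamma> {z \<in> space \<gamma>. h < norm (fst z - snd z)}"
  proof -
    have "(\<integral>\<^sup>+w. ennreal D * indicator {z \<in> space \<gamma>. h < norm (fst z - snd z)} (fst w) \<partial>\<pi>0)
        = (\<integral>\<^sup>+z. ennreal D * indicator {z \<in> space \<gamma>. h < norm (fst z - snd z)} z \<partial>distr \<pi>0 \<gamma> fst)"
      by (subst nn_integral_distr) measurable
    then show ?thesis by (simp add: m0 nn_integral_cmult_indicator)
  qed
  finally show ?thesis by (simp add: N1_def N2_def B_def)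
qed

section \<open>From transport costs to Wasserstein distances\<close>

lemma ennpowr_mono: "x \<le> y \<Longrightarrow> a \<ge> 0 \<Longrightarrow> ennpowr x a \<le> ennpowr y a"
  by (cases x; cases y) (auto simp: ennpowr_def top_unique intro!: ennreal_leI powr_mono2)

lemma ennpowr_ennreal: "x \<ge> 0 \<Longrightarrow> ennpowr (ennreal x) a = ennreal (x powr a)"
  by (simp add: ennpowr_def)

lemma wasserstein_le_of_cost_le:
  assumes "(INF \<pi>\<in>couplings \<mu> \<nu>. \<integral>\<^sup>+(x, y). ennreal (norm (x - y) powr q) \<partial>\<pi>) \<le> ennreal C"
    and "C \<ge> 0" "q > 0"
  shows "wasserstein q \<mu> \<nu> \<le> ennreal (C powr (1 / q))"
  using ennpowr_mono [OF assms(1), of "1 / q"] assms(2,3)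
  by (simp add: wasserstein_def ennpowr_ennreal)

lemma emeasure_far_le:
  fixes \<gamma> :: "('a::euclidean_space \<times> 'a) measure"
  assumes sets: "sets \<mu> = sets (restrict_space borel S)" "sets \<nu> = sets (restrict_space borel S)"
    and \<gamma>: "\<gamma> \<in> couplings \<mu> \<nu>" and h: "h > 0" and r: "r > 0"
  shows "ennreal (h powr r) * emeasure \<gamma> {z \<in> space \<gamma>. h < norm (fst z - snd z)}
      \<le> (\<integral>\<^sup>+(x, y). ennreal (norm (x - y) powr r) \<partial>\<gamma>)"
proof -
  have id: "(\<lambda>x. x) \<in> \<mu> \<rightarrow>\<^sub>M borel" "(\<lambda>x. x) \<in> \<nu> \<rightarrow>\<^sub>M borel"
    unfolding measurable_cong_sets [OF sets(1) refl] measurable_cong_sets [OF sets(2) refl]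
    by (rule measurable_restrict_space1; simp)+
  have sets_\<gamma>: "sets \<gamma> = sets (\<mu> \<Otimes>\<^sub>M \<nu>)" using \<gamma> by (simp add: couplings_def)
  have "(\<lambda>z. fst z) \<in> \<gamma> \<rightarrow>\<^sub>M borel" "(\<lambda>z. snd z) \<in> \<gamma> \<rightarrow>\<^sub>M borel"
    unfolding measurable_cong_sets [OF sets_\<gamma> refl]
    by (rule measurable_compose [OF measurable_fst id(1)], rule measurable_compose [OF measurable_snd id(2)])
  then have [measurable]: "(\<lambda>z. norm (fst z - snd z)) \<in> borel_measurable \<gamma>" by simp
  have "ennreal (h powr r) * emeasure \<gamma> {z \<in> space \<gamma>. h < norm (fst z - snd z)}
      = (\<integral>\<^sup>+z. ennreal (h powr r) * indicator {z \<in> space \<gamma>. h < norm (fst z - snd z)} z \<partial>\<gamma>)"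
    by (simp add: nn_integral_cmult_indicator)
  also have "\<dots> \<le> (\<integral>\<^sup>+z. ennreal (norm (fst z - snd z) powr r) \<partial>\<gamma>)"
    using h r by (intro nn_integral_mono) (auto simp: indicator_def intro!: ennreal_leI powr_mono2)
  finally show ?thesis by (simp only: case_prod_unfold)
qed

lemma le_powr_of_le_right_limit:
  fixes X :: ennreal
  assumes le: "\<And>t. t > t0 \<Longrightarrow> X \<le> ennreal (C * t powr a)" and "t0 \<ge> 0" "a > 0"
  shows "X \<le> ennreal (C * t0 powr a)"
proof (rule LIMSEQ_le_const)
  have lim: "(\<lambda>n. t0 + 1 / real (Suc n)) \<longlonglongrightarrow> t0 + 0"
    by (intro tendsto_intros LIMSEQ_Suc lim_const_over_n)
  have "(\<lambda>n. (t0 + 1 / real (Suc n)) powr a) \<longlonglongrightarrow> (t0 + 0) powr a"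
    by (rule tendsto_powr' [OF lim tendsto_const]) (use assms in auto)
  then have "(\<lambda>n. (t0 + 1 / real (Suc n)) powr a) \<longlonglongrightarrow> t0 powr a" by simp
  then show "(\<lambda>n. ennreal (C * (t0 + 1 / real (Suc n)) powr a)) \<longlonglongrightarrow> ennreal (C * t0 powr a)"
    by (intro tendsto_ennrealI tendsto_mult tendsto_const)
  show "\<exists>N. \<forall>n\<ge>N. X \<le> ennreal (C * (t0 + 1 / real (Suc n)) powr a)"
    by (intro exI allI impI le) simp
qed

text \<open>Only the factor \<open>b powr q\<close>, exponential in \<open>q\<close>, profits from the root; for the other factor
  \<open>a powr (1 / q) \<le> a\<close> is enough.\<close>

lemma powr_inverse_product_le:
  fixes a b q :: real
  assumes "a \<ge> 1" "b \<ge> 0" "q \<ge> 1"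
  shows "(a * b powr q) powr (1 / q) \<le> a * b"
proof -
  have "a powr (1 / q) \<le> a powr 1" using assms by (intro powr_mono) auto
  then have "a powr (1 / q) * b \<le> a * b" using assms by (intro mult_right_mono) auto
  then show ?thesis using assms by (simp add: powr_mult powr_powr)
qed

text \<open>With the finite-order distance the tail is at most \<open>t / h powr r\<close> for every \<open>t\<close> above the optimal
  cost, and \<open>h = t powr (1 / (r + 1))\<close> equalises it with \<open>h\<close>. With the distance of infinite order the
  tail is zero for \<open>h\<close> above the distance. In both cases \<open>t\<close> or \<open>h\<close> must stay strictly above the
  infimum, which is only approached by couplings, so the bound is obtained by a limit from the right.\<close>

lemma wasserstein_le_of_tradeoff:
  fixes \<mu> \<nu> \<rho> \<rho>' :: "'a::euclidean_space measure" and q A b K D :: real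
  assumes sets: "sets \<rho> = sets (restrict_space borel S)" "sets \<rho>' = sets (restrict_space borel S)"
    and KD: "K \<ge> 0" "D \<ge> 0" "K + D \<le> A * b powr q" and A: "A \<ge> 1" and b: "b > 0" and q: "q \<ge> 1"
    and tradeoff: "\<And>\<gamma> h. \<gamma> \<in> couplings \<rho> \<rho>' \<Longrightarrow> h > 0 \<Longrightarrow>
       (INF \<pi>\<in>couplings \<mu> \<nu>. \<integral>\<^sup>+(x, y). ennreal (norm (x - y) powr q) \<partial>\<pi>)
       \<le> ennreal (K * h) + ennreal D * emeasure \<gamma> {z \<in> space \<gamma>. h < norm (fst z - snd z)}"
  shows "r > 1 \<Longrightarrow> wasserstein q \<mu> \<nu>
           \<le> ennreal (A * b) * ennpowr (wasserstein r \<rho> \<rho>') (r / (q * (r + 1)))" (is "_ \<Longrightarrow> ?R")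
    and "wasserstein q \<mu> \<nu> \<le> ennreal (A * b) * ennpowr (wasserstein_inf \<rho> \<rho>') (1 / q)" (is ?I)
proof -
  define W where "W = wasserstein q \<mu> \<nu>"
  define V where "V = (INF \<pi>\<in>couplings \<mu> \<nu>. \<integral>\<^sup>+(x, y). ennreal (norm (x - y) powr q) \<partial>\<pi>)"
  have Ab: "A * b > 0" using A b by simp
  have W_le: "W \<le> ennreal (A * b * t powr (1 / q))" if t: "t > 0" and V: "V \<le> ennreal ((K + D) * t)" for t
  proof -
    have "W \<le> ennreal (((K + D) * t) powr (1 / q))"
      unfolding W_def using V KD q t by (intro wasserstein_le_of_cost_le) (auto simp: V_def)
    also have "((K + D) * t) powr (1 / q) = (K + D) powr (1 / q) * t powr (1 / q)"
      using KD t by (simp add: powr_mult)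
    also have "\<dots> \<le> (A * b powr q) powr (1 / q) * t powr (1 / q)"
      using KD q by (intro mult_right_mono powr_mono2) auto
    also have "\<dots> \<le> A * b * t powr (1 / q)"
      using A b q by (intro mult_right_mono powr_inverse_product_le) auto
    finally show ?thesis by (simp add: ennreal_leI)
  qed
  show ?R if r: "r > 1"
  proof -
    define I where "I = (INF \<gamma>\<in>couplings \<rho> \<rho>'. \<integral>\<^sup>+(x, y). ennreal (norm (x - y) powr r) \<partial>\<gamma>)"
    have Wr: "wasserstein r \<rho> \<rho>' = ennpowr I (1 / r)" by (simp add: wasserstein_def I_def)
    show ?thesis
    proof (cases "I = \<infinity>")
      case True
      then show ?thesis using Ab by (auto simp: Wr ennpowr_def ennreal_mult_top)
    next
      case False
      then obtain i where i: "i \<ge> 0" "I = ennreal i" by (cases I) auto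
      have le: "W \<le> ennreal (A * b * t powr (1 / (q * (r + 1))))" if t: "t > i" for t
      proof -
        have "I < ennreal t" using i t by (simp add: ennreal_less_iff)
        then obtain \<gamma> where \<gamma>: "\<gamma> \<in> couplings \<rho> \<rho>'"
            "(\<integral>\<^sup>+(x, y). ennreal (norm (x - y) powr r) \<partial>\<gamma>) < ennreal t"
          unfolding I_def by (auto simp: INF_less_iff)
        define F where "F k = emeasure \<gamma> {z \<in> space \<gamma>. k < norm (fst z - snd z)}" for k :: real
        \<comment> \<open>This \<open>h\<close> balances \<open>h\<close> against the tail bound \<open>t / h powr r\<close>.\<close>
        define h where "h = t powr (1 / (r + 1))"
        have h: "h > 0" using i t by (simp add: h_def)
        have "h powr (r + 1) = t" using i t r by (simp add: h_def powr_powr)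
        then have th: "t = h powr r * h" using h by (simp add: powr_add)
        have "ennreal (h powr r) * F h \<le> ennreal t"
          using emeasure_far_le [OF sets \<gamma>(1) h, of r] \<gamma>(2) r by (simp add: F_def)
        then have "ennreal (1 / h powr r) * (ennreal (h powr r) * F h) \<le> ennreal (1 / h powr r) * ennreal t"
          by (rule mult_left_mono) simp
        then have "F h \<le> ennreal h"
          using h by (simp add: th mult.assoc [symmetric] flip: ennreal_mult')
        then have "ennreal (K * h) + ennreal D * F h \<le> ennreal (K * h) + ennreal D * ennreal h"
          by (intro add_left_mono mult_left_mono) auto
        then have "V \<le> ennreal (K * h) + ennreal D * ennreal h"
          using tradeoff [OF \<gamma>(1) h] unfolding V_def F_def by (rule order_trans [rotated])
        also have "\<dots> = ennreal ((K + D) * h)"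
          using KD h by (simp add: distrib_right flip: ennreal_mult ennreal_plus)
        finally have "W \<le> ennreal (A * b * h powr (1 / q))" by (rule W_le [OF h])
        then show ?thesis by (simp add: h_def powr_powr mult.commute)
      qed
      have "W \<le> ennreal (A * b * i powr (1 / (q * (r + 1))))"
        by (rule le_powr_of_le_right_limit [OF le]) (use i q r in auto)
      moreover have "ennpowr (wasserstein r \<rho> \<rho>') (r / (q * (r + 1))) = ennreal (i powr (1 / (q * (r + 1))))"
        using i r by (simp add: Wr ennpowr_ennreal powr_powr)
      ultimately show ?thesis using Ab by (simp add: W_def ennreal_mult')
    qed
  qed
  show ?I
  proof (cases "wasserstein_inf \<rho> \<rho>' = \<infinity>")
    case True
    then show ?thesis using Ab by (auto simp: ennpowr_def ennreal_mult_top)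
  next
    case False
    then obtain i where i: "i \<ge> 0" "wasserstein_inf \<rho> \<rho>' = ennreal i"
      by (cases "wasserstein_inf \<rho> \<rho>'") auto
    have le: "W \<le> ennreal (A * b * h powr (1 / q))" if h: "h > i" for h
    proof -
      have "wasserstein_inf \<rho> \<rho>' < ennreal h" using i h by (simp add: ennreal_less_iff)
      then obtain \<gamma> where \<gamma>: "\<gamma> \<in> couplings \<rho> \<rho>'" "esssup \<gamma> (\<lambda>(x, y). ennreal (norm (x - y))) < ennreal h"
        unfolding wasserstein_inf_def by (auto simp: INF_less_iff)
      have "AE z in \<gamma>. (case z of (x, y) \<Rightarrow> ennreal (norm (x - y))) \<le> esssup \<gamma> (\<lambda>(x, y). ennreal (norm (x - y)))"
        by (rule esssup_AE)
      then have "AE z in \<gamma>. \<not> h < norm (fst z - snd z)"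
      proof eventually_elim
        case (elim z)
        then have "ennreal (norm (fst z - snd z)) < ennreal h" using \<gamma>(2) by (auto simp: case_prod_beta)
        then show ?case by (simp add: ennreal_less_iff)
      qed
      then have "emeasure \<gamma> {z \<in> space \<gamma>. h < norm (fst z - snd z)} = 0" by (rule emeasure_eq_0_AE)
      then have "V \<le> ennreal (K * h)" using tradeoff [OF \<gamma>(1), of h] h i by (simp add: V_def)
      also have "\<dots> \<le> ennreal ((K + D) * h)"
        using KD h i by (intro ennreal_leI mult_right_mono) auto
      finally show ?thesis using h i by (intro W_le) auto
    qed
    have "W \<le> ennreal (A * b * i powr (1 / q))"
      by (rule le_powr_of_le_right_limit [OF le]) (use i q in auto)
    then show ?thesis using i Ab by (simp add: W_def ennpowr_ennreal ennreal_mult')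
  qed
qed

section \<open>Stability of the pushforward\<close>

lemma nn_integral_le_of_RN_deriv_le:
  fixes \<Omega> :: "'a::euclidean_space set"
  assumes \<Omega>: "\<Omega> \<in> sets borel" and \<rho>: "\<rho> \<in> borel_probs \<Omega>"
    and ac: "absolutely_continuous (restrict_space lborel \<Omega>) \<rho>"
    and M: "AE x in restrict_space lborel \<Omega>. RN_deriv (restrict_space lborel \<Omega>) \<rho> x \<le> ennreal M"
    and H: "H \<in> borel_measurable borel"
  shows "(\<integral>\<^sup>+x. H x \<partial>\<rho>) \<le> ennreal M * (\<integral>\<^sup>+x. H x \<partial>lborel)"
proof -
  define L where "L = restrict_space (lborel :: 'a measure) \<Omega>"
  interpret L: sigma_finite_measure L
    unfolding L_def using \<Omega> by (intro sigma_finite_measure_restrict_space sigma_finite_lborel) simp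
  have sets: "sets \<rho> = sets L"
    using \<rho> by (simp add: borel_probs_def L_def sets_restrict_space)
  have HL: "H \<in> borel_measurable L" unfolding L_def using H by (intro measurable_restrict_space1) simp
  have "(\<integral>\<^sup>+x. H x \<partial>\<rho>) = (\<integral>\<^sup>+x. RN_deriv L \<rho> x * H x \<partial>L)"
    by (rule L.RN_deriv_nn_integral [OF ac [folded L_def] sets HL])
  also have "\<dots> \<le> (\<integral>\<^sup>+x. ennreal M * H x \<partial>L)"
    using M [folded L_def] by (intro nn_integral_mono_AE) (auto intro: mult_right_mono elim!: eventually_mono)
  also have "\<dots> = ennreal M * (\<integral>\<^sup>+x. H x \<partial>L)" using HL by (rule nn_integral_cmult)
  also have "(\<integral>\<^sup>+x. H x \<partial>L) = (\<integral>\<^sup>+x. H x * indicator \<Omega> x \<partial>lborel)"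
    unfolding L_def using \<Omega> by (intro nn_integral_restrict_space) simp
  also have "\<dots> \<le> (\<integral>\<^sup>+x. H x \<partial>lborel)"
    by (intro nn_integral_mono) (auto simp: indicator_def)
  finally show ?thesis by (simp add: mult_left_mono)
qed

lemma AE_of_absolutely_continuous_restrict:
  fixes \<Omega> :: "'a::euclidean_space set"
  assumes \<Omega>: "\<Omega> \<in> sets borel" and \<rho>: "\<rho> \<in> borel_probs \<Omega>"
    and ac: "absolutely_continuous (restrict_space lborel \<Omega>) \<rho>"
    and ae: "AE x in lborel. x \<in> \<Omega> \<longrightarrow> P x"
  shows "AE x in \<rho>. P x"
proof (rule absolutely_continuous_AE [OF _ ac])
  show "sets \<rho> = sets (restrict_space lborel \<Omega>)"
    using \<rho> by (simp add: borel_probs_def sets_restrict_space)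
  show "AE x in restrict_space lborel \<Omega>. P x"
    using ae \<Omega> by (subst AE_restrict_space_iff) auto
qed

text \<open>The number \<open>264 = 6 * 44\<close> collects the absolute constants of the final estimate.\<close>

lemma numeric_dimension_bound:
  assumes "n \<ge> 1"
  shows "264 * real n ^ 4 * 2 ^ n \<le> 2 ^ (8 * (n + 1)) * (real n)\<^sup>2"
proof -
  have "real n < 2 ^ n" using of_nat_less_two_power by blast
  then have "(real n)\<^sup>2 * 2 ^ n \<le> (2 ^ n)\<^sup>2 * 2 ^ n"
    by (intro mult_right_mono power_mono) auto
  also have "\<dots> = (8 :: real) ^ n" by (simp add: power2_eq_square flip: power_mult_distrib)
  finally have 1: "(real n)\<^sup>2 * 2 ^ n \<le> 8 ^ n" .
  have "(32 :: real) ^ 1 \<le> 32 ^ n" using assms by (intro power_increasing) auto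
  then have "264 * (8 :: real) ^ n \<le> 256 * (32 ^ n * 8 ^ n)" by simp
  also have "\<dots> = 2 ^ (8 * (n + 1))"
    by (simp add: power_mult power_add flip: power_mult_distrib)
  finally have "264 * (8 :: real) ^ n \<le> 2 ^ (8 * (n + 1))" .
  with 1 have "264 * ((real n)\<^sup>2 * 2 ^ n) \<le> 2 ^ (8 * (n + 1))" by linarith
  then have "264 * ((real n)\<^sup>2 * 2 ^ n) * (real n)\<^sup>2 \<le> 2 ^ (8 * (n + 1)) * (real n)\<^sup>2"
    by (intro mult_right_mono) auto
  then show ?thesis by (simp add: power4_eq_xxxx power2_eq_square mult_ac)
qed

theorem theorem3p2:
  fixes p R M\<^sub>\<rho> :: real
    and \<Omega> :: "'a::euclidean_space set"
    and \<rho> \<rho>' :: "'a measure"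
    and \<phi> :: "'a \<Rightarrow> real"
    and \<gamma>' :: "('a \<times> 'a) measure"
    and T :: "'a \<Rightarrow> 'a"
  assumes "p \<ge> 2" and "R > 0" and "\<Omega> = ball 0 R"
    and "\<rho> \<in> borel_probs \<Omega>" and "\<rho>' \<in> borel_probs \<Omega>"
    and "absolutely_continuous (restrict_space lborel \<Omega>) \<rho>"
    and "M\<^sub>\<rho> > 0"
    and "AE x in restrict_space lborel \<Omega>.
           RN_deriv (restrict_space lborel \<Omega>) \<rho> x \<le> ennreal M\<^sub>\<rho>"
    and "continuous_on \<Omega> \<phi>"
    and "\<forall>x\<in>\<Omega>. ereal (\<phi> x) = cbar_transform (p_cost p) (c_transform \<Omega> (p_cost p) \<phi>) x"
    and "\<gamma>' \<in> borel_probs (\<Omega> \<times> \<Omega>)"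
    and "distr \<gamma>' (restrict_space borel \<Omega>) fst = \<rho>'"
    and "spt \<gamma>' \<subseteq> c_superdifferential \<Omega> (p_cost p) \<phi>"
    and "is_ot_map p \<Omega> \<phi> T"
  shows "\<forall>q>p - 1.
    (\<forall>r>1. wasserstein q (distr \<rho> (restrict_space borel \<Omega>) T)
                          (distr \<gamma>' (restrict_space borel \<Omega>) snd)
        \<le> ennreal (stability_const DIM('a) q p R M\<^sub>\<rho>)
            * ennpowr (wasserstein r \<rho> \<rho>') (r / (q * (r + 1)))) \<and>
    wasserstein q (distr \<rho> (restrict_space borel \<Omega>) T)
                  (distr \<gamma>' (restrict_space borel \<Omega>) snd)
      \<le> ennreal (stability_const DIM('a) q p R M\<^sub>\<rho>)
          * ennpowr (wasserstein_inf \<rho> \<rho>') (1 / q)"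
proof (intro allI impI)
  fix q :: real assume q: "q > p - 1"
  note p = assms(1) and R = assms(2) and \<Omega> = assms(3) and \<rho> = assms(4) and \<rho>' = assms(5)
    and M = assms(7)
  define d where "d = DIM('a)"
  define \<beta> where "\<beta> = unit_ball_vol (real d)"
  define \<Gamma> where "\<Gamma> = c_superdifferential \<Omega> (p_cost p) \<phi>"
  define E where "E = {x. (x, T x) \<in> \<Gamma>}"
  have q1: "q \<ge> 1" using p q by simp
  have d1: "real d \<ge> 1" by (simp add: d_def Suc_leI)
  have \<beta>: "\<beta> \<ge> 0" by (simp add: \<beta>_def)
  have open\<Omega>: "open \<Omega>" "\<Omega> \<in> sets borel" by (auto simp: \<Omega>)
  have \<Gamma>_sub: "\<Gamma> \<subseteq> ball 0 R \<times> ball 0 R" by (auto simp: \<Gamma>_def c_superdifferential_def \<Omega>)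
  have opt: "\<phi> x' \<le> \<phi> x + p_cost p x' y - p_cost p x y" if "(x, y) \<in> \<Gamma>" "(x', y') \<in> \<Gamma>" for x y x' y'
    using that by (simp add: \<Gamma>_def c_superdifferential_iff)
  have T: "T \<in> restrict_space borel \<Omega> \<rightarrow>\<^sub>M restrict_space borel \<Omega>"
    using assms(14) by (simp add: is_ot_map_def)
  have AE_E: "AE x in \<rho>. x \<in> E"
    using AE_ot_map_in_c_superdifferential [OF p open\<Omega>(1) assms(9,10,14)]
    by (intro AE_of_absolutely_continuous_restrict [OF open\<Omega>(2) \<rho> assms(6)]) (simp add: E_def \<Gamma>_def)
  have AE_\<Gamma>: "AE z in \<gamma>'. z \<in> \<Gamma>"
    using AE_in_spt [OF assms(11)] assms(13) by (auto simp: \<Gamma>_def elim!: eventually_mono)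
  interpret \<rho>: prob_space \<rho> using \<rho> by (simp add: borel_probs_def)
  have "\<Gamma> \<noteq> {}"
  proof
    assume "\<Gamma> = {}"
    with AE_E have "AE x in \<rho>. False" by (simp add: E_def)
    then show False by simp
  qed
  have dist_le: "norm (T x - y) \<le> 2 * R" if "x \<in> E" "(x', y) \<in> \<Gamma>" for x x' y
  proof -
    have "T x \<in> ball 0 R" "y \<in> ball 0 R" using that \<Gamma>_sub by (auto simp: E_def)
    then show ?thesis using norm_triangle_ineq4 [of "T x" y] by simp
  qed

  \<comment> \<open>\<open>K1\<close> serves for small \<open>h\<close>, where the displacement bound applies with \<open>\<eta> = 2 h\<close>. For large \<open>h\<close>
    the diameter bound \<open>D\<close> is already at most \<open>K2 h\<close>.\<close>
  define D where "D = (2 * R) powr q"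
  define C where "C = 11 * real d ^ 4 * p * \<beta> * (6 * R) powr (p - 1) * (2 * R) ^ (d - 1)"
  define K1 where "K1 = M\<^sub>\<rho> * ((2 * R) powr (q - (p - 1)) * (C * 2))"
  define K2 where "K2 = D * (4 * d / R)"
  have C: "C \<ge> 0" using p \<beta> R by (simp add: C_def)
  have nonneg: "D \<ge> 0" "K1 \<ge> 0" "K2 \<ge> 0" using R M C by (auto simp: D_def K1_def K2_def)
  have far: "norm (T x - y) powr q \<le> D" if "x \<in> E" "(x', y) \<in> \<Gamma>" for x x' y
    unfolding D_def using dist_le [OF that] q1 by (intro powr_mono2) auto
  have tradeoff: "(INF \<pi>\<in>couplings (distr \<rho> (restrict_space borel \<Omega>) T) (distr \<gamma>' (restrict_space borel \<Omega>) snd).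
            \<integral>\<^sup>+(x, y). ennreal (norm (x - y) powr q) \<partial>\<pi>)
      \<le> ennreal ((K1 + K2) * h) + ennreal D * emeasure \<gamma> {z \<in> space \<gamma>. h < norm (fst z - snd z)}"
    (is "?I \<le> _ + ?F")
    if \<gamma>: "\<gamma> \<in> couplings \<rho> \<rho>'" and h: "h > 0" for \<gamma> h
  proof -
    note glue = glued_coupling_cost_le [OF \<rho> \<rho>' assms(11,12) T \<gamma> h AE_E AE_\<Gamma>]
    show ?thesis
    proof (cases "2 * d * (2 * h) \<le> R")
      case True
      from h have "2 * h > 0" by simp
      obtain G where G: "G \<in> borel_measurable borel"
        and bound: "\<And>x y x' y'. (x, y) \<in> \<Gamma> \<Longrightarrow> (x', y') \<in> \<Gamma> \<Longrightarrow> norm (x' - x) \<le> 2 * h \<Longrightarrow>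
           norm (y - y') powr (p - 1) \<le> G x"
        and int: "(\<integral>\<^sup>+x. ennreal (G x) \<partial>lborel) \<le> ennreal (C * (2 * h))"
        unfolding C_def \<beta>_def d_def
      proof (rule displacement_bound_near_most_points [OF p R \<Gamma>_sub \<open>\<Gamma> \<noteq> {}\<close> _ \<open>2 * h > 0\<close>
            True [unfolded d_def], of \<phi>])
        show "\<phi> x' \<le> \<phi> x + p_cost p x' y - p_cost p x y" if "(x, y) \<in> \<Gamma>" "(x', y') \<in> \<Gamma>" for x y x' y'
          by (rule opt [OF that])
      qed blast
      define H where "H x = ennreal ((2 * R) powr (q - (p - 1))) * ennreal (G x)" for x
      have H: "H \<in> borel_measurable borel" unfolding H_def [abs_def] using G by measurable
      have "?I \<le> (\<integral>\<^sup>+x. H x \<partial>\<rho>) + ?F"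
      proof (rule glue [OF H])
        show "norm (T x - y) powr q \<le> D" if "x \<in> E" "(x', y) \<in> \<Gamma>" for x x' y
          by (rule far [OF that])
        fix x x' y assume x: "x \<in> E" and y: "(x', y) \<in> \<Gamma>" and n: "norm (x' - x) \<le> 2 * h"
        \<comment> \<open>The excess \<open>q - (p - 1) > 0\<close> of the exponent is absorbed by the diameter.\<close>
        define n where "n = norm (T x - y)"
        have "n powr q = n powr (q - (p - 1)) * n powr (p - 1)"
          unfolding powr_add [symmetric] by simp
        also have "\<dots> \<le> (2 * R) powr (q - (p - 1)) * G x"
          using dist_le [OF x y] bound [of x "T x" x' y] x y n q
          by (intro mult_mono powr_mono2) (auto simp: n_def E_def)
        finally show "ennreal (norm (T x - y) powr q) \<le> H x"
          by (simp add: H_def n_def ennreal_leI flip: ennreal_mult')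
      qed
      also have "(\<integral>\<^sup>+x. H x \<partial>\<rho>) \<le> ennreal M\<^sub>\<rho> * (\<integral>\<^sup>+x. H x \<partial>lborel)"
        by (rule nn_integral_le_of_RN_deriv_le [OF open\<Omega>(2) \<rho> assms(6,8) H])
      also have "(\<integral>\<^sup>+x. H x \<partial>lborel) = ennreal ((2 * R) powr (q - (p - 1))) * (\<integral>\<^sup>+x. ennreal (G x) \<partial>lborel)"
        unfolding H_def using G by (intro nn_integral_cmult) simp
      also have "ennreal M\<^sub>\<rho> * \<dots> \<le> ennreal M\<^sub>\<rho> * (ennreal ((2 * R) powr (q - (p - 1))) * ennreal (C * (2 * h)))"
        by (intro mult_left_mono int) auto
      also have "\<dots> = ennreal (M\<^sub>\<rho> * ((2 * R) powr (q - (p - 1)) * (C * (2 * h))))"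
        by (simp only: ennreal_mult' [symmetric] powr_ge_zero less_imp_le [OF M])
      also have "M\<^sub>\<rho> * ((2 * R) powr (q - (p - 1)) * (C * (2 * h))) = K1 * h"
        by (simp add: K1_def)
      also have "\<dots> \<le> ennreal ((K1 + K2) * h)"
        using nonneg h by (intro ennreal_leI mult_right_mono) auto
      finally show ?thesis by (simp add: add_right_mono)
    next
      case False
      have "D * 1 \<le> D * (4 * d / R * h)"
        using False R nonneg by (intro mult_left_mono) (auto simp: field_simps)
      also have "\<dots> = K2 * h" by (simp add: K2_def)
      also have "\<dots> \<le> (K1 + K2) * h" using nonneg h by (intro mult_right_mono) auto
      finally have "(\<integral>\<^sup>+x. ennreal D \<partial>\<rho>) \<le> ennreal ((K1 + K2) * h)"
        by (simp add: \<rho>.emeasure_space_1 ennreal_leI)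
      then have "(\<integral>\<^sup>+x. ennreal D \<partial>\<rho>) + ?F \<le> ennreal ((K1 + K2) * h) + ?F"
        by (rule add_right_mono)
      moreover have "?I \<le> (\<integral>\<^sup>+x. ennreal D \<partial>\<rho>) + ?F"
        by (rule glue) (use far in \<open>auto intro: ennreal_leI\<close>)
      ultimately show ?thesis by (rule order_trans [rotated])
    qed
  qed

  \<comment> \<open>Everything that grows exponentially with \<open>q\<close>, and hence with \<open>p\<close>, goes into \<open>b powr q\<close>, whose
    \<open>q\<close>-th root is \<open>b\<close>.\<close>
  define Z where "Z = real d ^ 4 * p * (1 + \<beta>) * (1 + M\<^sub>\<rho>) * 2 ^ d * (1 + R) ^ d"
  define b where "b = 6 * (1 + R)"
  have Z: "Z \<ge> real d"
  proof -
    have "1 * 1 * 1 * 1 * 1 * 1 \<le> real d ^ 3 * p * (1 + \<beta>) * (1 + M\<^sub>\<rho>) * 2 ^ d * (1 + R) ^ d"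
      using d1 p \<beta> M R by (intro mult_mono) auto
    then have "real d * 1 \<le> real d * (real d ^ 3 * p * (1 + \<beta>) * (1 + M\<^sub>\<rho>) * 2 ^ d * (1 + R) ^ d)"
      by (intro mult_left_mono) auto
    then show ?thesis by (simp add: Z_def power4_eq_xxxx power3_eq_cube mult_ac)
  qed
  have b: "b > 0" using R by (simp add: b_def)
  have Rb: "2 * R \<le> b" "6 * R \<le> b" "b \<ge> 1" using R by (auto simp: b_def)
  have const: "K1 + K2 + D \<le> 44 * Z * b powr q"
  proof -
    have "(2 * R) powr (q - (p - 1)) * (6 * R) powr (p - 1) \<le> b powr (q - (p - 1)) * b powr (p - 1)"
      using Rb R q p by (intro mult_mono powr_mono2) auto
    also have "\<dots> = b powr q" unfolding powr_add [symmetric] by simp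
    finally have 1: "(2 * R) powr (q - (p - 1)) * (6 * R) powr (p - 1) \<le> b powr q" .
    have 2: "(2 * R) ^ (d - 1) \<le> 2 ^ d * (1 + R) ^ d"
    proof -
      have "(2 * R) ^ (d - 1) \<le> (2 * (1 + R)) ^ (d - 1)" using R by (intro power_mono) auto
      also have "\<dots> \<le> (2 * (1 + R)) ^ d" using R by (intro power_increasing) auto
      finally show ?thesis by (simp only: power_mult_distrib)
    qed
    have "K1 = 22 * (real d ^ 4 * p * \<beta> * M\<^sub>\<rho> * ((2 * R) ^ (d - 1))) *
        ((2 * R) powr (q - (p - 1)) * (6 * R) powr (p - 1))"
      by (simp add: K1_def C_def mult_ac)
    also have "\<dots> \<le> 22 * (real d ^ 4 * p * (1 + \<beta>) * (1 + M\<^sub>\<rho>) * (2 ^ d * (1 + R) ^ d)) * b powr q"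
      using d1 p \<beta> M R 1 2 by (intro mult_mono) auto
    also have "\<dots> = 22 * Z * b powr q" by (simp add: Z_def mult_ac)
    finally have K1: "K1 \<le> 22 * Z * b powr q" .
    have "(2 * R) powr q = (2 * R) powr (q - 1) * (2 * R)"
      using R powr_add [of "2 * R" "q - 1" 1] by simp
    then have "K2 = 8 * real d * (2 * R) powr (q - 1)" using R by (simp add: K2_def D_def)
    also have "\<dots> \<le> 8 * Z * b powr q"
    proof -
      have "(2 * R) powr (q - 1) \<le> b powr (q - 1)" using R Rb q1 by (intro powr_mono2) auto
      also have "\<dots> \<le> b powr q" using Rb by (intro powr_mono) auto
      finally show ?thesis using Z d1 by (intro mult_mono) auto
    qed
    finally have K2: "K2 \<le> 8 * Z * b powr q" .
    have "D \<le> 1 * b powr q" unfolding D_def using R Rb q1 by (simp add: powr_mono2)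
    also have "\<dots> \<le> Z * b powr q" using Z d1 by (intro mult_right_mono) auto
    finally have "K1 + K2 + D \<le> 31 * (Z * b powr q)" using K1 K2 by simp
    also have "\<dots> \<le> 44 * (Z * b powr q)" using Z d1 by (intro mult_right_mono) auto
    finally show ?thesis by simp
  qed
  have stab: "44 * Z * b \<le> stability_const DIM('a) q p R M\<^sub>\<rho>"
  proof -
    have num: "264 * real d ^ 4 * 2 ^ d \<le> 2 ^ (8 * (d + 1)) * (real d)\<^sup>2"
      using d1 by (intro numeric_dimension_bound) auto
    have pp: "p \<le> p ^ 3" using p power_increasing [of 1 3 p] by simp
    have qq: "1 \<le> (q / (q - p + 1)) powr (1 / q)"
      using p q by (intro ge_one_powr_ge_zero) (auto simp: field_simps)
    have RR: "(1 + R) ^ (d + 1) \<le> (1 + R) powr (2 + p + real d)"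
    proof -
      have "(1 + R) ^ (d + 1) = (1 + R) powr real (d + 1)" using R by (intro powr_realpow [symmetric]) simp
      also have "\<dots> \<le> (1 + R) powr (2 + p + real d)" using R p by (intro powr_mono) auto
      finally show ?thesis .
    qed
    have "44 * Z * b = (264 * real d ^ 4 * 2 ^ d) * p * 1 * ((1 + \<beta>) * (1 + M\<^sub>\<rho>)) * (1 + R) ^ (d + 1)"
      by (simp add: Z_def b_def mult_ac)
    also have "\<dots> \<le> (2 ^ (8 * (d + 1)) * (real d)\<^sup>2) * p ^ 3 * (q / (q - p + 1)) powr (1 / q)
        * ((1 + \<beta>) * (1 + M\<^sub>\<rho>)) * (1 + R) powr (2 + p + real d)"
      using p \<beta> M R by (intro num pp qq RR order_refl mult_mono) auto
    also have "\<dots> = stability_const DIM('a) q p R M\<^sub>\<rho>"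
      by (simp add: stability_const_def d_def \<beta>_def mult_ac)
    finally show ?thesis .
  qed
  have sets: "sets \<rho> = sets (restrict_space borel \<Omega>)" "sets \<rho>' = sets (restrict_space borel \<Omega>)"
    using \<rho> \<rho>' by (auto simp: borel_probs_def)
  note result = wasserstein_le_of_tradeoff [OF sets _ nonneg(1) const _ b q1 tradeoff]
  have c1: "44 * Z \<ge> 1" using Z d1 by simp
  have K: "K1 + K2 \<ge> 0" using nonneg by simp
  have enlarge: "ennreal (44 * Z * b) * x \<le> ennreal (stability_const DIM('a) q p R M\<^sub>\<rho>) * x" for x
    by (intro mult_right_mono ennreal_leI stab) simp
  show "(\<forall>r>1. wasserstein q (distr \<rho> (restrict_space borel \<Omega>) T)
                          (distr \<gamma>' (restrict_space borel \<Omega>) snd)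
        \<le> ennreal (stability_const DIM('a) q p R M\<^sub>\<rho>)
            * ennpowr (wasserstein r \<rho> \<rho>') (r / (q * (r + 1)))) \<and>
    wasserstein q (distr \<rho> (restrict_space borel \<Omega>) T)
                  (distr \<gamma>' (restrict_space borel \<Omega>) snd)
      \<le> ennreal (stability_const DIM('a) q p R M\<^sub>\<rho>)
          * ennpowr (wasserstein_inf \<rho> \<rho>') (1 / q)"
    using order_trans [OF result(1) enlarge] order_trans [OF result(2) enlarge] K c1 by blast
qed

end
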